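(* Let $X$ be a Banach space as described in the context, assume $\mu_1:=\liminf_{n\to\infty}\|z^n\|^{1/n}>0$ and $\mu_2:=\limsup_{n\to\infty}\|z^n\|^{1/n}<\infty$, and let $f\in X$. If $f$ is (the restriction to $\mathbb{D}$ of) an entire function of finite order $\rho\in(0,\infty)$, then $$\limsup_{n\to\infty}\frac{n\ln n}{\ln\frac{\|z^n\|}{E_n(f)}}=\rho .$$ Conversely, if this equality holds for some $\rho\in(0,\infty)$, then the sequence $(p_n^* )$ of polynomials of best approximation of $f$ in the norm of $X$ converges uniformly in each disk $|z|<r$, $r\in(0,\mu_1)$, to some entire function of finite order $\rho$.
   Context: $\mathbb{D}=\{z\in\mathbb{C}:|z|<1\}$. Here $X$ is a complex Banach space of functions defined in $\mathbb{D}$ (not necessarily analytic) whose norm $\|\cdot\|$ satisfies: (i) $\|f(\cdot\, e^{it})\|=\|f(\cdot)\|$ for all $t\in\mathbb{R}$ and $f\in X$; (ii) $\|f\|<\infty$ for every entire function $f$; (iii) for all $f\in X$ and $g\in L[0,2\pi]$, $\big\|\frac{1}{2\pi}\int_0^{2\pi} f(ze^{it})g(t)\,dt\big\|\le \frac{1}{2\pi}\int_0^{2\pi}|g(t)|\,dt\cdot\|f\|$. For $n\ge 1$, $\mathcal{P}_n$ is the set of complex polynomials of degree at most $n-1$, $E_n(f)=\inf_{p\in\mathcal{P}_n}\|f-p\|$, $p_n^*\in\mathcal{P}_n$ is a polynomial with $\|f-p_n^*\|=E_n(f)$, and $\|z^n\|$ is the norm in $X$ of $z\mapsto z^n$. The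 order of an entire function $F$ is $\limsup_{r\to\infty}\frac{\ln\ln M(r)}{\ln r}$, $M(r)=\max_{|z|=r}|F(z)|$. *)

theory Defs
  imports "HOL-Complex_Analysis.Complex_Analysis" "HOL-Computational_Algebra.Polynomial"
begin

text \<open>Functions "defined in the unit disc" are represented by functions on the whole
  complex plane that vanish outside the open unit disc.  restrD F is the restriction
  of F to the disc in this representation.\<close>

definition restrD :: "(complex \<Rightarrow> complex) \<Rightarrow> complex \<Rightarrow> complex" where
  "restrD F = (\<lambda>z. if norm z < 1 then F z else 0)"

definition banach_fun_space :: "(complex \<Rightarrow> complex) set \<Rightarrow> ((complex \<Rightarrow> complex) \<Rightarrow> real) \<Rightarrow> bool" where
  "banach_fun_space X N \<longleftrightarrow>
     (\<forall>f\<in>X. \<forall>z. 1 \<le> norm z \<longrightarrow> f z = 0) \<and>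
     (\<lambda>z. 0) \<in> X \<and>
     (\<forall>f\<in>X. \<forall>g\<in>X. (\<lambda>z. f z + g z) \<in> X) \<and>
     (\<forall>c::complex. \<forall>f\<in>X. (\<lambda>z. c * f z) \<in> X) \<and>
     (\<forall>f\<in>X. 0 \<le> N f) \<and>
     (\<forall>f\<in>X. N f = 0 \<longleftrightarrow> f = (\<lambda>z. 0)) \<and>
     (\<forall>c::complex. \<forall>f\<in>X. N (\<lambda>z. c * f z) = norm c * N f) \<and>
     (\<forall>f\<in>X. \<forall>g\<in>X. N (\<lambda>z. f z + g z) \<le> N f + N g) \<and>
     (\<forall>s::nat \<Rightarrow> complex \<Rightarrow> complex. (\<forall>n. s n \<in> X) \<and>
         (\<forall>e>0. \<exists>M. \<forall>m\<ge>M. \<forall>n\<ge>M. N (\<lambda>z. s m z - s n z) < e)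
       \<longrightarrow> (\<exists>l\<in>X. (\<lambda>n. N (\<lambda>z. s n z - l z)) \<longlonglongrightarrow> 0))"

definition admissible_space :: "(complex \<Rightarrow> complex) set \<Rightarrow> ((complex \<Rightarrow> complex) \<Rightarrow> real) \<Rightarrow> bool" where
  "admissible_space X N \<longleftrightarrow>
     banach_fun_space X N \<and>
     (\<forall>f\<in>X. \<forall>t::real. (\<lambda>z. f (z * cis t)) \<in> X \<and> N (\<lambda>z. f (z * cis t)) = N f) \<and>
     (\<forall>F. F holomorphic_on UNIV \<longrightarrow> restrD F \<in> X) \<and>
     (\<forall>f\<in>X. \<forall>g::real \<Rightarrow> complex.
        set_integrable lborel {0..2*pi} g \<longrightarrow>
        (\<forall>z. norm z < 1 \<longrightarrow> set_integrable lborel {0..2*pi} (\<lambda>t. f (z * cis t) * g t)) \<longrightarrow>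
        (restrD (\<lambda>z. (LINT t:{0..2*pi}|lborel. f (z * cis t) * g t) / (2 * pi)) \<in> X \<and>
         N (restrD (\<lambda>z. (LINT t:{0..2*pi}|lborel. f (z * cis t) * g t) / (2 * pi)))
           \<le> (LINT t:{0..2*pi}|lborel. norm (g t)) / (2 * pi) * N f))"

definition best_err :: "((complex \<Rightarrow> complex) \<Rightarrow> real) \<Rightarrow> nat \<Rightarrow> (complex \<Rightarrow> complex) \<Rightarrow> real" where
  "best_err N n f = (INF p \<in> {p :: complex poly. degree p < n}. N (\<lambda>z. f z - restrD (poly p) z))"

definition is_best_approx :: "((complex \<Rightarrow> complex) \<Rightarrow> real) \<Rightarrow> nat \<Rightarrow> (complex \<Rightarrow> complex) \<Rightarrow> complex poly \<Rightarrow> bool" where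
  "is_best_approx N n f p \<longleftrightarrow> degree p < n \<and> N (\<lambda>z. f z - restrD (poly p) z) = best_err N n f"

definition znorm :: "((complex \<Rightarrow> complex) \<Rightarrow> real) \<Rightarrow> nat \<Rightarrow> real" where
  "znorm N n = N (restrD (\<lambda>z. z ^ n))"

definition max_modulus :: "(complex \<Rightarrow> complex) \<Rightarrow> real \<Rightarrow> real" where
  "max_modulus F r = Sup ((\<lambda>z. norm (F z)) ` sphere 0 r)"

definition entire_order :: "(complex \<Rightarrow> complex) \<Rightarrow> ereal" where
  "entire_order F = Limsup at_top (\<lambda>r::real. ereal (ln (ln (max_modulus F r)) / ln r))"

end

theory Submission
  imports Defs "HOL-Real_Asymp.Real_Asymp"
begin

text \<open>Write \<open>w\<^sub>n\<close> for the norm of \<open>z^n\<close>, \<open>E\<^sub>n\<close> for the best error and \<open>a\<^sub>n\<close> for the Taylor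
  coefficients of \<open>F\<close>.  Convolution with \<open>e^{-int}\<close> gives \<open>|a\<^sub>n| w\<^sub>n \<le> E\<^sub>n\<close>, and the Taylor sums
  give \<open>E\<^sub>n \<le> \<Sum>k\<ge>n. |a\<^sub>k| w\<^sub>k\<close>.  As \<open>w\<^sub>n\<close> lies between two geometric sequences, up to an
  arbitrarily small change of \<open>\<sigma>\<close> the bounds \<open>|a\<^sub>n| \<le> n^(-n/\<sigma>)\<close> and \<open>E\<^sub>n \<le> w\<^sub>n n^(-n/\<sigma>)\<close> are
  equivalent; the first one says that the order of \<open>F\<close> is at most \<open>\<sigma>\<close>, the second one is the
  upper bound on the limsup.  For the converse, the differences \<open>p\<^sub>n\<^sub>+\<^sub>1 - p\<^sub>n\<close> have norm at most
  \<open>2 E\<^sub>n\<close>, which bounds their coefficients; hence \<open>p\<^sub>n\<close> converges locally uniformly in the whole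
  plane, and the limit restricts to \<open>f\<close> because the norm of an entire function is bounded
  by its maximum on a large disc.\<close>

section \<open>Entire power series on circles\<close>

text \<open>Convergence at every point makes F entire with Taylor coefficients a at 0. The
  coefficients are a parameter so that the estimates can refer to them directly.\<close>

definition entire_series :: "(nat \<Rightarrow> complex) \<Rightarrow> (complex \<Rightarrow> complex) \<Rightarrow> bool" where
  "entire_series a F \<longleftrightarrow> (\<forall>z. (\<lambda>k. a k * z ^ k) sums F z)"

lemma holomorphic_imp_entire_series:
  assumes "F holomorphic_on UNIV"
  obtains a where "entire_series a F"
proof -
  have "(\<lambda>n. (deriv ^^ n) F 0 / fact n * (z - 0) ^ n) sums F z" for z
    by (rule holomorphic_power_series[of F 0 "norm z + 1"]) (use assms holomorphic_on_subset in auto)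
  then show thesis using that[of "\<lambda>n. (deriv ^^ n) F 0 / fact n"]
    by (simp add: entire_series_def)
qed

lemma entire_series_summable_norm:
  assumes "entire_series a F"
  shows "summable (\<lambda>k. norm (a k) * r ^ k)"
proof -
  \<comment> \<open>Convergence at a point of modulus larger than that of r gives absolute
    convergence at r.\<close>
  have "summable (\<lambda>k. a k * of_real (\<bar>r\<bar> + 1) ^ k)"
    using assms by (auto simp: entire_series_def sums_iff)
  then have "summable (\<lambda>k. norm (a k * of_real r ^ k))"
    by (rule powser_insidea) (simp add: norm_of_real del: of_real_add)
  then have "summable (\<lambda>k. norm (norm (a k) * r ^ k))"
    by (simp add: norm_mult norm_power abs_mult power_abs)
  then show ?thesis by (rule summable_norm_cancel)
qed

lemma cis_integral:
  "(LINT t:{0..2*pi}|lborel. cis (of_int m * t)) = (if m = 0 then 2 * pi else 0)"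
proof (cases "m = 0")
  case True
  then show ?thesis by (simp add: set_integral_const scaleR_conv_of_real)
next
  case False
  define G where "G = (\<lambda>t. cis (of_int m * t) / (\<i> * of_int m))"
  have der: "(G has_vector_derivative cis (of_int m * t)) (at t within A)" for t A
    unfolding G_def using False
    by (auto simp: has_vector_derivative_def scaleR_conv_of_real fun_eq_iff field_simps
        intro!: derivative_eq_intros)
  have "((\<lambda>t. cis (of_int m * t)) has_integral G (2*pi) - G 0) {0..2*pi}"
    by (rule fundamental_theorem_of_calculus) (auto intro: der)
  moreover have "G (2*pi) = G 0"
    unfolding G_def using cis_multiple_2pi[of "of_int m"] by (simp add: mult_ac)
  moreover have "set_integrable lborel {0..2*pi} (\<lambda>t. cis (of_int m * t))"
    by (rule borel_integrable_atLeastAtMost') (auto intro!: continuous_intros)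
  ultimately show ?thesis using False
    by (simp add: set_borel_integral_eq_integral(2) integral_unique)
qed

lemma entire_series_holomorphic:
  assumes "entire_series a F"
  shows "F holomorphic_on A"
proof -
  have eq: "F = (\<lambda>z. \<Sum>k. a k * z ^ k)"
    using assms by (auto simp: entire_series_def sums_iff)
  have "F field_differentiable at z" for z
    unfolding eq field_differentiable_def
    by (rule exI, rule termdiffs_strong[of _ "of_real (norm z + 1)"])
      (use assms in \<open>auto simp: entire_series_def sums_iff norm_of_real simp del: of_real_add\<close>)
  then show ?thesis
    by (auto simp: holomorphic_on_def intro: field_differentiable_at_within)
qed

lemma entire_series_continuous:
  assumes "entire_series a F"
  shows "continuous_on A F"
  using entire_series_holomorphic[OF assms] by (rule holomorphic_on_imp_continuous_on)

text \<open>Termwise integration leaves only the term k = j, because the characters are orthogonal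
  (\<open>cis_integral\<close>).\<close>

lemma fourier_coeff:
  fixes z :: complex
  assumes "entire_series a F"
  shows "(LINT t:{0..2*pi}|lborel. F (z * cis t) * cis (-(real j * t))) = 2 * pi * (a j * z ^ j)"
proof -
  let ?I = "{0..2*pi}"
  \<comment> \<open>The indicator moves the interval into the integrand, so that
    \<open>sums_integral\<close> can be applied over the whole line.\<close>
  define u where "u = (\<lambda>k t. indicator ?I t *\<^sub>R (a k * z ^ k * cis (of_int (int k - int j) * t)))"
  have c: "a k * (z * cis t) ^ k * cis (-(real j * t)) = a k * z ^ k * cis (of_int (int k - int j) * t)" for k t
    by (simp only: power_mult_distrib Complex.DeMoivre mult.assoc cis_mult) (simp add: algebra_simps)
  have int: "integrable lborel (u k)" for k
    using borel_integrable_atLeastAtMost'[of 0 "2*pi" "\<lambda>t. a k * z ^ k * cis (of_int (int k - int j) * t)"]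
    unfolding u_def set_integrable_def by (simp add: continuous_intros)
  have val: "integral\<^sup>L lborel (u k) = a k * z ^ k * (if k = j then 2 * pi else 0)" for k
    using cis_integral[of "int k - int j"]
    unfolding u_def set_lebesgue_integral_def[symmetric] by (simp add: set_integral_mult_right)
  have sm: "summable (\<lambda>k. norm (a k) * norm z ^ k)"
    by (rule entire_series_summable_norm[OF assms])
  have nu: "norm (u k t) = indicator ?I t * (norm (a k) * norm z ^ k)" for k t
    by (simp add: u_def norm_mult norm_power)
  have "(\<lambda>k. integral\<^sup>L lborel (u k)) sums (\<integral>t. (\<Sum>k. u k t) \<partial>lborel)"
  proof (rule sums_integral[OF int])
    show "AE t in lborel. summable (\<lambda>k. norm (u k t))"
      unfolding nu by (intro AE_I2 summable_mult sm)
    have "(\<integral>t. norm (u k t) \<partial>lborel) = 2 * pi * (norm (a k) * norm z ^ k)" for k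
      unfolding nu by simp
    then show "summable (\<lambda>k. \<integral>t. norm (u k t) \<partial>lborel)"
      using sm by (simp add: summable_mult)
  qed
  moreover have "(\<Sum>k. u k t) = indicator ?I t *\<^sub>R (F (z * cis t) * cis (-(real j * t)))" for t
  proof -
    have "(\<lambda>k. a k * (z * cis t) ^ k * cis (-(real j * t))) sums (F (z * cis t) * cis (-(real j * t)))"
      using assms by (intro sums_mult2) (auto simp: entire_series_def)
    then have "u k t = indicator ?I t *\<^sub>R (a k * (z * cis t) ^ k * cis (-(real j * t)))" 
      "(\<lambda>k. indicator ?I t *\<^sub>R (a k * (z * cis t) ^ k * cis (-(real j * t)))) sums 
        (indicator ?I t *\<^sub>R (F (z * cis t) * cis (-(real j * t))))" for k
      by (simp_all only: u_def c sums_scaleR_right)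
    then show ?thesis unfolding u_def c by (simp add: sums_iff)
  qed
  moreover have "(\<lambda>k. integral\<^sup>L lborel (u k)) sums (2 * pi * (a j * z ^ j))"
  proof -
    have "(\<lambda>k. integral\<^sup>L lborel (u k)) = (\<lambda>k. if k = j then 2 * pi * (a j * z ^ j) else 0)"
      by (auto simp: val)
    then show ?thesis using sums_single[of j "\<lambda>_. 2 * pi * (a j * z ^ j)"] by simp
  qed
  ultimately show ?thesis
    unfolding set_lebesgue_integral_def using sums_unique2 by fastforce
qed

lemma circle_integrable:
  assumes "entire_series a F" "continuous_on UNIV g"
  shows "set_integrable lborel {0..2*pi} (\<lambda>t. F (z * cis t) * g t)"
  by (intro borel_integrable_atLeastAtMost' continuous_intros continuous_on_subset[OF assms(2)]
        continuous_on_compose2[OF entire_series_continuous[OF assms(1), of UNIV]]) auto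

text \<open>On the circle the integrand of \<open>fourier_coeff\<close> at the point r has modulus
  at most M.\<close>

lemma Cauchy_estimate:
  assumes "entire_series a F" "\<And>z. norm z = r \<Longrightarrow> norm (F z) \<le> M" "0 \<le> r"
  shows "norm (a j) * r ^ j \<le> M"
proof -
  let ?f = "\<lambda>t. F (of_real r * cis t) * cis (-(real j * t))"
  have "norm (LINT t:{0..2*pi}|lborel. ?f t) \<le> (LINT t:{0..2*pi}|lborel. norm (?f t))"
    by (rule set_integral_norm_bound) (rule circle_integrable[OF assms(1)], intro continuous_intros)
  also have "\<dots> \<le> (LINT t:{0..2*pi}|lborel. M)"
  proof (rule set_integral_mono)
    show "set_integrable lborel {0..2*pi} (\<lambda>t. norm (?f t))"
      by (intro set_integrable_norm circle_integrable[OF assms(1)] continuous_intros)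
    show "set_integrable lborel {0..2*pi} (\<lambda>t. M)"
      by (rule borel_integrable_atLeastAtMost') auto
  qed (use assms in \<open>auto simp: norm_mult\<close>)
  also have "\<dots> = 2 * pi * M" by (simp add: set_integral_const)
  finally show ?thesis using assms(3)
    unfolding fourier_coeff[OF assms(1), of "of_real r" j] by (simp add: norm_mult norm_power)
qed

text \<open>F is bounded on the circle, so absolute summability of b allows termwise integration,
  and \<open>fourier_coeff\<close> evaluates each term. Convolution with such a kernel thus acts as
  a multiplier on Taylor coefficients.\<close>

lemma fourier_series:
  assumes F: "entire_series a F" and b: "summable (\<lambda>j. norm (b j))"
  shows "(\<lambda>j. b j * (a j * z ^ j)) sums
    ((LINT t:{0..2*pi}|lborel. F (z * cis t) * (\<Sum>j. b j * cis (-(real j * t)))) / (2 * pi))"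
proof -
  let ?I = "{0..2*pi}"
  define u where "u = (\<lambda>j t. indicator ?I t *\<^sub>R (F (z * cis t) * (b j * cis (-(real j * t)))))"
  have int: "integrable lborel (u j)" for j
    using circle_integrable[OF F, of "\<lambda>t. b j * cis (-(real j * t))" z]
    unfolding u_def set_integrable_def by (simp add: continuous_intros)
  have val: "integral\<^sup>L lborel (u j) = 2 * pi * (b j * (a j * z ^ j))" for j
    using fourier_coeff[OF F, of z j]
    unfolding u_def set_lebesgue_integral_def[symmetric] 
    by (simp add: mult.left_commute[of _ "b j"] set_integral_mult_right)
  \<comment> \<open>The bound K on the compact circle turns summability of b into an integrable
    majorant for the terms.\<close>
  have "compact ((\<lambda>t. F (z * cis t)) ` ?I)"
    using entire_series_continuous[OF F, of UNIV]
    by (intro compact_continuous_image) (auto intro!: continuous_on_compose2[of UNIV F] continuous_intros)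
  then obtain K where K: "\<And>t. t \<in> ?I \<Longrightarrow> norm (F (z * cis t)) \<le> K"
    by (meson bounded_iff compact_imp_bounded image_eqI)
  have K0: "0 \<le> K" using K[of 0] norm_ge_zero by (meson atLeastAtMost_iff order.refl order.trans pi_ge_zero mult_nonneg_nonneg zero_le_numeral)
  have nu: "norm (u j t) \<le> indicator ?I t * (K * norm (b j))" for j t
    using K[of t] by (auto simp: u_def norm_mult indicator_def intro!: mult_right_mono)
  have "(\<lambda>j. integral\<^sup>L lborel (u j)) sums (\<integral>t. (\<Sum>j. u j t) \<partial>lborel)"
  proof (rule sums_integral[OF int])
    have "summable (\<lambda>j. norm (u j t))" for t
      by (rule summable_comparison_test'[OF summable_mult[OF summable_mult[OF b]]]) (use nu in auto)
    then show "AE t in lborel. summable (\<lambda>j. norm (u j t))" by simp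
    have i: "integrable lborel (\<lambda>t. indicator ?I t * (K * norm (b j)))" for j
      by (simp add: mult.commute)
    have "(\<integral>t. norm (u j t) \<partial>lborel) \<le> (\<integral>t. indicator ?I t * (K * norm (b j)) \<partial>lborel)" for j
      by (rule integral_mono[OF integrable_norm[OF int] i nu])
    then have "(\<integral>t. norm (u j t) \<partial>lborel) \<le> 2 * pi * (K * norm (b j))" for j
      by simp
    then show "summable (\<lambda>j. \<integral>t. norm (u j t) \<partial>lborel)"
      by (intro summable_comparison_test'[OF summable_mult[OF summable_mult[OF b]], of 0 _ "2*pi" K]) auto
  qed
  moreover have "(\<Sum>j. u j t) = indicator ?I t *\<^sub>R (F (z * cis t) * (\<Sum>j. b j * cis (-(real j * t))))" for t
  proof -
    have "summable (\<lambda>j. norm (b j * cis (-(real j * t))))"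
      using b by (simp add: norm_mult)
    then have "summable (\<lambda>j. b j * cis (-(real j * t)))"
      by (rule summable_norm_cancel)
    then show ?thesis unfolding u_def
      by (simp add: suminf_mult suminf_scaleR_right[symmetric] summable_mult)
  qed
  ultimately have "(\<lambda>j. 2 * pi * (b j * (a j * z ^ j))) sums 
     (LINT t:?I|lborel. F (z * cis t) * (\<Sum>j. b j * cis (-(real j * t))))"
    unfolding val set_lebesgue_integral_def by simp
  from sums_divide[OF this, of "2 * pi"] show ?thesis by simp
qed

section \<open>Order and Taylor coefficients\<close>

text \<open>After taking logarithms, n ln n with the positive factor \<open>\<delta>\<close>
  outgrows every linear function of n. In this way geometric factors are paid for by enlarging the
  exponent.\<close>

lemma superexp_absorb:
  fixes \<sigma> \<tau> K C :: real
  assumes "0 < \<sigma>" "\<sigma> < \<tau>" "0 < K" "0 < C"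
  shows "eventually (\<lambda>n. C * K ^ n * real n powr (- real n / \<sigma>) \<le> real n powr (- real n / \<tau>)) sequentially"
proof -
  define \<delta> where "\<delta> = 1 / \<sigma> - 1 / \<tau>"
  have "\<delta> > 0" using assms by (simp add: \<delta>_def field_simps)
  then have "eventually (\<lambda>n. ln C + real n * ln K \<le> \<delta> * (real n * ln (real n))) sequentially"
    by real_asymp
  with eventually_gt_at_top[of 0] show ?thesis
  proof eventually_elim
    case (elim n)
    have "C * K ^ n * real n powr (- real n / \<sigma>) = exp (ln C + real n * ln K - real n / \<sigma> * ln (real n))"
      using elim assms by (simp add: exp_add exp_diff powr_def exp_minus divide_inverse exp_of_nat_mult)
    also have "\<dots> \<le> exp (- real n / \<tau> * ln (real n))"
      using elim by (simp add: \<delta>_def algebra_simps)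
    also have "\<dots> = real n powr (- real n / \<tau>)"
      using elim by (simp add: powr_def)
    finally show ?case .
  qed
qed

lemma superexp_tendsto_0:
  fixes \<sigma> K :: real
  assumes "0 < \<sigma>" "0 < K"
  shows "(\<lambda>n. K ^ n * real n powr (- real n / \<sigma>)) \<longlonglongrightarrow> 0"
proof (rule tendsto_sandwich[OF _ _ tendsto_const])
  show "eventually (\<lambda>n. K ^ n * real n powr (- real n / \<sigma>) \<le> real n powr (- real n / (\<sigma> + 1))) sequentially"
    using superexp_absorb[of \<sigma> "\<sigma> + 1" K 1] assms by simp
  show "(\<lambda>n. real n powr (- real n / (\<sigma> + 1))) \<longlonglongrightarrow> 0"
    using assms by real_asymp
qed (use assms in auto)

section \<open>Maximum modulus and order\<close>

lemma norm_le_max_modulus: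
  assumes "continuous_on UNIV F" "norm z = r"
  shows "norm (F z) \<le> max_modulus F r"
  unfolding max_modulus_def
proof (rule cSup_upper)
  have "compact ((\<lambda>z. norm (F z)) ` sphere 0 r)"
    by (intro compact_continuous_image continuous_intros continuous_on_subset[OF assms(1)]) auto
  then show "bdd_above ((\<lambda>z. norm (F z)) ` sphere 0 r)"
    by (intro bounded_imp_bdd_above compact_imp_bounded)
qed (use assms in auto)

lemma max_modulus_le:
  assumes "0 \<le> r" "\<And>z. norm z = r \<Longrightarrow> norm (F z) \<le> M"
  shows "max_modulus F r \<le> M"
  unfolding max_modulus_def
proof (rule cSup_least)
  have "of_real r \<in> sphere (0::complex) r" using assms by simp
  then show "(\<lambda>z. norm (F z)) ` sphere 0 r \<noteq> {}" by blast
qed (use assms in auto)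

text \<open>For \<tau> between the order and \<sigma>, the maximum modulus is at most exp(r^\<tau>)
  for large r. Cauchy's estimate at r = n^(1/\<tau>) gives the bound e^n n^(-n/\<tau>), and passing
  from \<tau> to \<sigma> absorbs e^n.\<close>

lemma coeff_bound_of_entire_order:
  assumes F: "entire_series a F" and ord: "entire_order F < ereal \<sigma>" and "0 < \<sigma>"
  shows "eventually (\<lambda>n. norm (a n) \<le> real n powr (- real n / \<sigma>)) sequentially"
proof -
  \<comment> \<open>The maximum with 0 provides a positive \<tau> whatever the sign of the
    order.\<close>
  have "max (entire_order F) 0 < ereal \<sigma>" using assms by simp
  then obtain \<tau> where "max (entire_order F) 0 < ereal \<tau>" "ereal \<tau> < ereal \<sigma>"
    using ereal_dense2 by blast
  then have \<tau>: "entire_order F < ereal \<tau>" "0 < \<tau>" "\<tau> < \<sigma>" by auto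
  have "eventually (\<lambda>r. ereal (ln (ln (max_modulus F r)) / ln r) < ereal \<tau>) at_top"
    using \<tau>(1) unfolding entire_order_def by (rule Limsup_lessD)
  with eventually_gt_at_top[of 1]
  have M: "eventually (\<lambda>r. \<forall>j. norm (a j) * r ^ j \<le> exp (r powr \<tau>)) at_top"
  proof eventually_elim
    case (elim r)
    define M where "M = max_modulus F r"
    have M0: "0 \<le> M" using norm_le_max_modulus[OF entire_series_continuous[OF F], of "of_real r" r] elim
      unfolding M_def by (smt (verit) norm_ge_zero norm_of_real)
    have "M \<le> exp (r powr \<tau>)"
    \<comment> \<open>For M \<le> 1 the double logarithm says nothing about M, but then the bound is
      trivial.\<close>
    proof (cases "M \<le> 1")
      case True
      then show ?thesis by (smt (verit) one_le_exp_iff powr_ge_zero)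
    next
      case False
      then have "0 < ln M" by simp
      moreover have "ln (ln M) < \<tau> * ln r" using elim by (simp add: M_def field_simps)
      ultimately have "ln M < r powr \<tau>" using elim
        by (metis exp_less_cancel_iff exp_ln less_trans mult.commute powr_def zero_less_one less_numeral_extra(3))
      then show ?thesis using False by (metis exp_less_cancel_iff exp_ln less_eq_real_def linorder_not_le less_trans zero_less_one)
    qed
    moreover have "norm (a j) * r ^ j \<le> M" for j
      by (rule Cauchy_estimate[OF F]) (use elim norm_le_max_modulus[OF entire_series_continuous[OF F]] in \<open>auto simp: M_def\<close>)
    ultimately show ?case using order_trans by blast
  qed
  \<comment> \<open>Up to a constant factor this radius minimises exp(r^\<tau>) / r^n, and it turns
    the exponential into e^n.\<close>
  have "filterlim (\<lambda>n. real n powr (1 / \<tau>)) at_top sequentially"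
    using \<tau> by real_asymp
  from eventually_compose_filterlim[OF M this]
  have "eventually (\<lambda>n. \<forall>j. norm (a j) * (real n powr (1 / \<tau>)) ^ j \<le> exp ((real n powr (1 / \<tau>)) powr \<tau>)) sequentially" .
  moreover have "eventually (\<lambda>n. exp 1 ^ n * real n powr (- real n / \<tau>) \<le> real n powr (- real n / \<sigma>)) sequentially"
    using superexp_absorb[of \<tau> \<sigma> "exp 1" 1] \<tau> by simp
  ultimately show ?thesis using eventually_gt_at_top[of 0]
  proof eventually_elim
    case (elim n)
    have "norm (a n) * (real n powr (1 / \<tau>)) ^ n \<le> exp ((real n powr (1 / \<tau>)) powr \<tau>)"
      using elim by blast
    also have "(real n powr (1 / \<tau>)) powr \<tau> = real n" using \<tau> elim by (simp add: powr_powr)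
    also have "(real n powr (1 / \<tau>)) ^ n = real n powr (real n / \<tau>)"
      using elim by (simp add: powr_powr flip: powr_realpow)
    finally have "norm (a n) \<le> exp 1 ^ n * real n powr (- real n / \<tau>)"
      using elim by (simp add: powr_minus field_simps flip: exp_of_nat_mult)
    also have "\<dots> \<le> real n powr (- real n / \<sigma>)" using elim by simp
    finally show ?case .
  qed
qed

text \<open>The series is split at m, about (2r)^\<sigma> with r the modulus of z. Beyond m,
  n^(1/\<sigma>) is at least 2r, so the terms are at most 2^(-n); before m, r^n is at most
  r^m.\<close>

lemma norm_le_of_coeff_bound:
  assumes F: "entire_series a F" and \<sigma>: "0 < \<sigma>"
    and bd: "\<And>n. n \<ge> n0 \<Longrightarrow> norm (a n) \<le> real n powr (- real n / \<sigma>)"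
    and r: "1 \<le> norm z"
  shows "norm (F z) \<le> (\<Sum>n. norm (a n)) * norm z powr ((2 * norm z) powr \<sigma> + real n0 + 1) + 2"
proof -
  define r where "r = norm z"
  \<comment> \<open>The summand n0 ensures that the coefficient bound is available for all n \<ge>
    m.\<close>
  define m where "m = nat \<lceil>(2 * r) powr \<sigma>\<rceil> + n0"
  note r = r[folded r_def]
  have sm: "summable (\<lambda>n. norm (a n))" using entire_series_summable_norm[OF F, of 1] by simp
  have m: "(2 * r) powr \<sigma> \<le> real m" "real m \<le> (2 * r) powr \<sigma> + real n0 + 1"
    unfolding m_def by (auto simp: of_nat_nat powr_ge_zero ceiling_mono) linarith+
  \<comment> \<open>Adding the bounds of the two ranges gives one summable majorant for all
    n.\<close>
  have tm: "norm (a n * z ^ n) \<le> norm (a n) * r ^ m + (1/2) ^ n" for n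
  proof (cases "n < m")
    case True
    have "r ^ n \<le> r ^ m" using True r by (intro power_increasing) auto
    then show ?thesis by (simp add: norm_mult norm_power r_def mult_left_mono add_increasing2)
  next
    case False
    then have n: "(2 * r) powr \<sigma> \<le> real n" "n \<ge> n0" using m by (auto simp: m_def)
    have pos: "0 < real n" using n(1) r by (smt (verit) powr_gt_zero)
    have "2 * r = ((2 * r) powr \<sigma>) powr (1 / \<sigma>)" using r \<sigma> by (simp add: powr_powr)
    also have "\<dots> \<le> real n powr (1 / \<sigma>)" using n \<sigma> by (intro powr_mono2) auto
    finally have le: "(2 * r) ^ n \<le> (real n powr (1 / \<sigma>)) ^ n" using r by (intro power_mono) auto
    have "norm (a n) * r ^ n \<le> real n powr (- real n / \<sigma>) * r ^ n"
      using bd[OF n(2)] r by (intro mult_right_mono) auto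
    also have "real n powr (- real n / \<sigma>) = inverse ((real n powr (1 / \<sigma>)) ^ n)"
      using pos by (simp add: powr_powr powr_minus flip: powr_realpow)
    also have "\<dots> * r ^ n \<le> inverse ((2 * r) ^ n) * r ^ n"
      using le r by (intro mult_right_mono le_imp_inverse_le) auto
    also have "\<dots> = (1/2) ^ n" using r by (simp add: power_mult_distrib field_simps)
    finally show ?thesis using r
      by (simp add: norm_mult norm_power r_def) (smt (verit) mult_nonneg_nonneg norm_ge_zero zero_le_power)
  qed
  have s: "(\<lambda>n. norm (a n) * r ^ m + (1/2) ^ n) sums ((\<Sum>n. norm (a n)) * r ^ m + 2)"
    using geometric_sums[of "1/2::real"] by (intro sums_add sums_mult2 summable_sums sm) auto
  have "norm (F z) \<le> (\<Sum>n. norm (a n)) * r ^ m + 2"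
  proof -
    have eq: "F z = (\<Sum>n. a n * z ^ n)" using F by (simp add: entire_series_def sums_iff)
    show ?thesis unfolding eq using norm_suminf_le[OF tm sums_summable[OF s]] sums_unique[OF s] by simp
  qed
  also have "r ^ m = r powr real m" using r by (simp add: powr_realpow)
  also have "(\<Sum>n. norm (a n)) * \<dots> \<le> (\<Sum>n. norm (a n)) * r powr ((2 * r) powr \<sigma> + real n0 + 1)"
    using m r by (intro mult_left_mono suminf_nonneg sm powr_mono) auto
  finally show ?thesis unfolding r_def by simp
qed

text \<open>The logarithm of the bound in \<open>norm_le_of_coeff_bound\<close> grows like
  r^\<sigma> ln r, hence more slowly than r^\<tau> for every \<tau> > \<sigma>.\<close>

lemma entire_order_le_of_coeff_bound:
  assumes F: "entire_series a F" and \<sigma>: "0 < \<sigma>"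
    and bd: "eventually (\<lambda>n. norm (a n) \<le> real n powr (- real n / \<sigma>)) sequentially"
  shows "entire_order F \<le> ereal \<sigma>"
\<comment> \<open>For a constant F the double logarithm need not be meaningful, but it is a fixed
  number, and divided by ln r it tends to 0.\<close>
proof (cases "\<forall>k\<ge>1. a k = 0")
  case True
  have "F z = a 0" for z
  proof -
    have "(\<lambda>k. a k * z ^ k) sums (a 0 * z ^ 0)"
      using sums_If_finite[of "\<lambda>k. k = 0" "\<lambda>k. a k * z ^ k"] True
      by (intro sums_cong[THEN iffD1, OF _ sums_single[of 0 "\<lambda>k. a k * z ^ k"]]) auto
    then show ?thesis using F by (auto simp: entire_series_def intro: sums_unique2)
  qed
  then have "max_modulus F r = norm (a 0)" if "0 \<le> r" for r
    using that norm_le_max_modulus[OF entire_series_continuous[OF F], of "of_real r" r]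
    by (intro antisym max_modulus_le) auto
  then have "eventually (\<lambda>r. ereal (ln (ln (norm (a 0))) / ln r) = ereal (ln (ln (max_modulus F r)) / ln r)) at_top"
    by (intro eventually_mono[OF eventually_ge_at_top[of 0]]) simp
  moreover have "((\<lambda>r. ereal (ln (ln (norm (a 0))) / ln r)) \<longlongrightarrow> ereal 0) at_top"
    by (rule tendsto_ereal) real_asymp
  ultimately have "((\<lambda>r. ereal (ln (ln (max_modulus F r)) / ln r)) \<longlongrightarrow> ereal 0) at_top"
    by (rule Lim_transform_eventually[rotated])
  then have "entire_order F = ereal 0" unfolding entire_order_def
    by (intro lim_imp_Limsup) auto
  then show ?thesis using \<sigma> by simp
next
  case False
  then obtain k where k: "k \<ge> 1" "a k \<noteq> 0" by blast
  show ?thesis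
  proof (rule ccontr)
    assume "\<not> ?thesis"
    then obtain \<tau> where \<tau>: "\<sigma> < \<tau>" "ereal \<tau> < entire_order F"
      using ereal_dense2[of "ereal \<sigma>"] by (auto simp: not_le)
    obtain n0 where n0: "\<And>n. n \<ge> n0 \<Longrightarrow> norm (a n) \<le> real n powr (- real n / \<sigma>)"
      using bd by (auto simp: eventually_sequentially)
    define C where "C = (\<Sum>n. norm (a n))"
    have sm: "summable (\<lambda>n. norm (a n))" using entire_series_summable_norm[OF F, of 1] by simp
    have "C > 0" unfolding C_def using k by (intro suminf_pos2[OF sm, of k]) auto
    then have "eventually (\<lambda>r. C * r powr ((2 * r) powr \<sigma> + real n0 + 1) + 2 \<le> exp (r powr \<tau>)) at_top"
      using \<sigma> \<tau> by real_asymp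
    \<comment> \<open>A nonzero coefficient of positive index forces the maximum modulus above e, so
      its logarithm is at least 1 and the second logarithm is monotone there.\<close>
    moreover have "eventually (\<lambda>r. exp 1 \<le> norm (a k) * r ^ k) at_top"
      using k by real_asymp
    ultimately have "eventually (\<lambda>r. ereal (ln (ln (max_modulus F r)) / ln r) \<le> ereal \<tau>) at_top"
      using eventually_gt_at_top[of 1]
    proof eventually_elim
      case (elim r)
      define M where "M = max_modulus F r"
      have "norm (a k) * r ^ k \<le> M" unfolding M_def
        by (rule Cauchy_estimate[OF F]) (use elim norm_le_max_modulus[OF entire_series_continuous[OF F]] in auto)
      with elim have lo: "exp 1 \<le> M" by linarith
      have "M \<le> C * r powr ((2 * r) powr \<sigma> + real n0 + 1) + 2" unfolding M_def C_def
      proof (rule max_modulus_le)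
        fix z :: complex assume "norm z = r"
        with norm_le_of_coeff_bound[OF F \<sigma> n0, of n0 z] elim
        show "norm (F z) \<le> (\<Sum>n. norm (a n)) * r powr ((2 * r) powr \<sigma> + real n0 + 1) + 2" by simp
      qed (use elim in auto)
      also have "\<dots> \<le> exp (r powr \<tau>)" using elim by simp
      finally have hi: "M \<le> exp (r powr \<tau>)" .
      have Mpos: "0 < M" using lo exp_gt_zero[of "1::real"] by linarith
      have "1 \<le> ln M" using lo Mpos by (simp add: ln_ge_iff)
      moreover have "ln M \<le> r powr \<tau>" using hi Mpos by (metis exp_gt_zero ln_exp ln_le_cancel_iff)
      ultimately have "ln (ln M) \<le> ln (r powr \<tau>)" by (intro ln_mono) auto
      also have "\<dots> = \<tau> * ln r" using elim by (simp add: ln_powr)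
      finally show ?case using elim by (simp add: M_def field_simps)
    qed
    then have "entire_order F \<le> ereal \<tau>" unfolding entire_order_def by (rule Limsup_bounded)
    with \<tau> show False by simp
  qed
qed

section \<open>Taylor coefficients and best approximation\<close>

lemma entire_series_scale:
  "entire_series a F \<Longrightarrow> entire_series (\<lambda>k. a k * c ^ k) (\<lambda>z. F (c * z))"
  by (simp add: entire_series_def mult.assoc flip: power_mult_distrib)

lemma entire_series_remainder:
  assumes "entire_series a F"
  shows "entire_series (\<lambda>k. if k < n then 0 else a k) (\<lambda>z. F z - (\<Sum>k<n. a k * z ^ k))"
  unfolding entire_series_def
proof
  fix z
  have "(\<lambda>k. if k < n then a k * z ^ k else 0) sums (\<Sum>k<n. a k * z ^ k)"
    using sums_If_finite_set[of "{..<n}" "\<lambda>k. a k * z ^ k"] by simp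
  then have "(\<lambda>k. a k * z ^ k - (if k < n then a k * z ^ k else 0)) sums (F z - (\<Sum>k<n. a k * z ^ k))"
    using assms by (intro sums_diff) (auto simp: entire_series_def)
  then show "(\<lambda>k. (if k < n then 0 else a k) * z ^ k) sums (F z - (\<Sum>k<n. a k * z ^ k))"
    by (rule sums_cong[THEN iffD1, rotated]) auto
qed

lemma entire_series_poly: "entire_series (coeff p) (poly p)"
  unfolding entire_series_def
proof
  fix z
  have "(\<lambda>k. coeff p k * z ^ k) sums (\<Sum>k\<le>degree p. coeff p k * z ^ k)"
    by (rule sums_finite) (auto simp: coeff_eq_0)
  then show "(\<lambda>k. coeff p k * z ^ k) sums poly p z" by (simp add: poly_altdef)
qed

lemma entire_series_diff:
  "entire_series a F \<Longrightarrow> entire_series b G \<Longrightarrow> entire_series (\<lambda>k. a k - b k) (\<lambda>z. F z - G z)"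
  by (auto simp: entire_series_def left_diff_distrib intro: sums_diff)

lemma restrD_diff: "(\<lambda>z. restrD F z - restrD G z) = restrD (\<lambda>z. F z - G z)"
  by (auto simp: restrD_def)

section \<open>Norm estimates from convolution\<close>

locale admissible =
  fixes X :: "(complex \<Rightarrow> complex) set" and N :: "(complex \<Rightarrow> complex) \<Rightarrow> real"
  assumes admissible: "admissible_space X N"
begin

lemma space: "banach_fun_space X N"
  using admissible unfolding admissible_space_def by blast

lemma
  shows add_in: "f \<in> X \<Longrightarrow> g \<in> X \<Longrightarrow> (\<lambda>z. f z + g z) \<in> X"
    and scale_in: "f \<in> X \<Longrightarrow> (\<lambda>z. c * f z) \<in> X"
    and N_nonneg: "f \<in> X \<Longrightarrow> 0 \<le> N f"
    and N_eq_0: "f \<in> X \<Longrightarrow> N f = 0 \<longleftrightarrow> f = (\<lambda>z. 0)"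
    and N_scale: "f \<in> X \<Longrightarrow> N (\<lambda>z. c * f z) = norm c * N f"
    and N_add: "f \<in> X \<Longrightarrow> g \<in> X \<Longrightarrow> N (\<lambda>z. f z + g z) \<le> N f + N g"
  using space unfolding banach_fun_space_def by blast+

lemma diff_in: "f \<in> X \<Longrightarrow> g \<in> X \<Longrightarrow> (\<lambda>z. f z - g z) \<in> X"
  using add_in[OF _ scale_in[of g "-1"], of f] by simp

lemma N_diff: "f \<in> X \<Longrightarrow> g \<in> X \<Longrightarrow> N (\<lambda>z. f z - g z) \<le> N f + N g"
  using N_add[OF _ scale_in[of g "-1"], of f] N_scale[of g "-1"] by simp

lemma restrD_in: "entire_series a F \<Longrightarrow> restrD F \<in> X"
  using admissible entire_series_holomorphic unfolding admissible_space_def by blast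

lemma restrD_poly_in: "restrD (poly p) \<in> X"
  by (rule restrD_in[OF entire_series_poly])

lemma N_convolution:
  assumes F: "entire_series a F" and g: "continuous_on UNIV g"
  shows "N (restrD (\<lambda>z. (LINT t:{0..2*pi}|lborel. F (z * cis t) * g t) / (2 * pi)))
    \<le> (LINT t:{0..2*pi}|lborel. norm (g t)) / (2 * pi) * N (restrD F)"
proof -
  have eq: "restrD F (z * cis t) = F (z * cis t)" if "norm z < 1" for z t
    using that by (simp add: restrD_def norm_mult)
  have "set_integrable lborel {0..2*pi} g"
    by (intro borel_integrable_atLeastAtMost' continuous_on_subset[OF g]) auto
  moreover have "set_integrable lborel {0..2*pi} (\<lambda>t. restrD F (z * cis t) * g t)" if "norm z < 1" for z
    unfolding eq[OF that] by (rule circle_integrable[OF F g])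
  ultimately have "N (restrD (\<lambda>z. (LINT t:{0..2*pi}|lborel. restrD F (z * cis t) * g t) / (2 * pi)))
      \<le> (LINT t:{0..2*pi}|lborel. norm (g t)) / (2 * pi) * N (restrD F)"
    using admissible restrD_in[OF F] unfolding admissible_space_def by blast
  also have "restrD (\<lambda>z. (LINT t:{0..2*pi}|lborel. restrD F (z * cis t) * g t) / (2 * pi))
      = restrD (\<lambda>z. (LINT t:{0..2*pi}|lborel. F (z * cis t) * g t) / (2 * pi))"
    by (rule ext, subst (1 3) restrD_def) (simp add: eq)
  finally show ?thesis .
qed

text \<open>By \<open>fourier_series\<close> the multiplier b is convolution with the kernel g,
  whose modulus is at most the sum of the |b j|; so is its mean over the circle.\<close>

lemma N_multiplier:
  assumes F: "entire_series a F" and b: "summable (\<lambda>j. norm (b j))"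
  shows "N (restrD (\<lambda>z. \<Sum>j. b j * (a j * z ^ j))) \<le> (\<Sum>j. norm (b j)) * N (restrD F)"
proof -
  define g where "g = (\<lambda>t. \<Sum>j. b j * cis (-(real j * t)))"
  \<comment> \<open>Uniform convergence makes g continuous, as \<open>N_convolution\<close>
    requires.\<close>
  have unif: "uniform_limit UNIV (\<lambda>n t. \<Sum>j<n. b j * cis (-(real j * t))) g sequentially"
    unfolding g_def by (rule Weierstrass_m_test[OF _ b]) (simp add: norm_mult)
  have g: "continuous_on UNIV g"
    by (rule uniform_limit_theorem[OF _ unif]) (auto intro!: always_eventually continuous_intros)
  have bnd: "norm (g t) \<le> (\<Sum>j. norm (b j))" for t
    unfolding g_def by (rule norm_suminf_le[OF _ b]) (simp add: norm_mult)
  have "(LINT t:{0..2*pi}|lborel. norm (g t)) \<le> (LINT t:{0..2*pi}|lborel. (\<Sum>j. norm (b j)))"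
    using bnd by (intro set_integral_mono set_integrable_norm borel_integrable_atLeastAtMost' continuous_on_subset[OF g]) auto
  then have "(LINT t:{0..2*pi}|lborel. norm (g t)) / (2 * pi) \<le> (\<Sum>j. norm (b j))"
    by (simp add: set_integral_const field_simps)
  then have "(LINT t:{0..2*pi}|lborel. norm (g t)) / (2 * pi) * N (restrD F) \<le> (\<Sum>j. norm (b j)) * N (restrD F)"
    by (rule mult_right_mono[OF _ N_nonneg[OF restrD_in[OF F]]])
  with N_convolution[OF F g] show ?thesis
    using sums_unique[OF fourier_series[OF F b]] by (simp add: g_def)
qed

lemma pow_in: "restrD (\<lambda>z. z ^ n) \<in> X"
  using restrD_poly_in[of "monom 1 n"] by (simp add: poly_monom[abs_def])

lemma znorm_pos: "0 < znorm N n"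
proof -
  have "restrD (\<lambda>z. z ^ n) (1/2) \<noteq> 0" by (simp add: restrD_def)
  then show ?thesis using N_nonneg[OF pow_in] N_eq_0[OF pow_in] unfolding znorm_def
    by (metis less_eq_real_def)
qed

lemma N_monomial: "N (restrD (\<lambda>z. c * z ^ n)) = norm c * znorm N n"
proof -
  have "restrD (\<lambda>z. c * z ^ n) = (\<lambda>z. c * restrD (\<lambda>z. z ^ n) z)" by (auto simp: restrD_def)
  then show ?thesis using N_scale[OF pow_in] by (simp add: znorm_def)
qed

text \<open>The multiplier that is 1 at n and 0 elsewhere has total mass 1 and extracts the n-th
  Taylor term: a Cauchy estimate in the norm of the space.\<close>

lemma coeff_znorm_le:
  assumes F: "entire_series a F"
  shows "norm (a n) * znorm N n \<le> N (restrD F)"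
proof -
  let ?b = "\<lambda>j. if j = n then 1 else 0 :: complex"
  have "(\<lambda>j. norm (?b j)) sums 1" using sums_single[of n "\<lambda>_. 1::real"] by (simp add: if_distrib cong: if_cong)
  moreover have "(\<lambda>j. ?b j * (a j * z ^ j)) sums (a n * z ^ n)" for z
    using sums_single[of n "\<lambda>j. a j * z ^ j"] by (simp add: if_distrib[of "\<lambda>x. x * _"] cong: if_cong)
  ultimately show ?thesis
    using N_multiplier[OF F, of ?b] by (simp add: sums_iff N_monomial)
qed

text \<open>Norm convergence in the space does not imply pointwise convergence, so the limit of the
  partial sums cannot be identified by completeness.  The remainder is instead the convolution of
  \<open>F (2 z)\<close> with a geometric kernel of norm \<open>2 (1/2)^n\<close>.\<close>

lemma remainder_tendsto_0:
  assumes F: "entire_series a F"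
  shows "(\<lambda>n. N (restrD (\<lambda>z. F z - (\<Sum>k<n. a k * z ^ k)))) \<longlonglongrightarrow> 0"
proof (rule tendsto_sandwich[OF _ _ tendsto_const])
  let ?F = "\<lambda>z. F (2 * z)"
  show "eventually (\<lambda>n. 0 \<le> N (restrD (\<lambda>z. F z - (\<Sum>k<n. a k * z ^ k)))) sequentially"
    by (intro always_eventually allI N_nonneg restrD_in[OF entire_series_remainder[OF F]])
  have "N (restrD (\<lambda>z. F z - (\<Sum>k<n. a k * z ^ k))) \<le> (2 * (1/2) ^ n) * N (restrD ?F)" for n
  proof -
    let ?b = "\<lambda>j. if j < n then 0 else (1/2) ^ j :: complex"
    have "(\<lambda>j. norm (?b (j + n))) sums (2 * (1/2) ^ n)"
      using sums_mult[OF geometric_sums[of "1/2::real"], of "(1/2)^n"]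
      by (simp add: norm_mult norm_power norm_divide power_add mult.commute)
    then have b: "(\<lambda>j. norm (?b j)) sums (2 * (1/2) ^ n)"
      using sums_iff_shift[of "\<lambda>j. norm (?b j)" n "2 * (1/2) ^ n"] by simp
    have "(\<lambda>j. ?b j * (a j * 2 ^ j * z ^ j)) = (\<lambda>k. (if k < n then 0 else a k) * z ^ k)" for z
      by (auto simp: power_divide)
    then have "(\<Sum>j. ?b j * (a j * 2 ^ j * z ^ j)) = F z - (\<Sum>k<n. a k * z ^ k)" for z
      using entire_series_remainder[OF F, of n] by (simp add: entire_series_def sums_iff)
    then show ?thesis
      using N_multiplier[OF entire_series_scale[OF F, of 2], of ?b] b by (simp add: sums_iff)
  qed
  then show "eventually (\<lambda>n. N (restrD (\<lambda>z. F z - (\<Sum>k<n. a k * z ^ k))) \<le> (2 * (1/2) ^ n) * N (restrD ?F)) sequentially"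
    by simp
  show "(\<lambda>n. (2 * (1/2) ^ n) * N (restrD ?F)) \<longlonglongrightarrow> 0"
    by (intro tendsto_mult_left_zero tendsto_mult_right_zero LIMSEQ_realpow_zero) auto
qed

lemma N_partial_sum: "N (restrD (\<lambda>z. \<Sum>k<n. a k * z ^ k)) \<le> (\<Sum>k<n. norm (a k) * znorm N k)"
proof (induction n)
  case 0
  have "restrD (\<lambda>z. 0) = (\<lambda>z. 0)" by (auto simp: restrD_def)
  then show ?case using N_monomial[of 0 0] by simp
next
  case (Suc n)
  have eq: "restrD (\<lambda>z. \<Sum>k<Suc n. a k * z ^ k) =
     (\<lambda>z. restrD (\<lambda>z. \<Sum>k<n. a k * z ^ k) z + restrD (\<lambda>z. a n * z ^ n) z)"
    by (auto simp: restrD_def)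
  have 1: "restrD (\<lambda>z. \<Sum>k<n. a k * z ^ k) \<in> X"
    using restrD_poly_in[of "\<Sum>k<n. monom (a k) k"] by (simp add: poly_sum[abs_def] poly_monom)
  have 2: "restrD (\<lambda>z. a n * z ^ n) \<in> X"
    using restrD_poly_in[of "monom (a n) n"] by (simp add: poly_monom[abs_def])
  show ?case using N_add[OF 1 2] Suc N_monomial[of "a n" n] unfolding eq by simp
qed

text \<open>The triangle inequality covers finite partial sums only; the remainder is split off, and
  its norm tends to 0 by \<open>remainder_tendsto_0\<close>.\<close>

lemma N_le_coeff_sum:
  assumes F: "entire_series a F" and sm: "summable (\<lambda>k. norm (a k) * znorm N k)"
  shows "N (restrD F) \<le> (\<Sum>k. norm (a k) * znorm N k)"
proof -
  let ?S = "\<lambda>n z. \<Sum>k<n. a k * z ^ k"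
  have "N (restrD F) \<le> N (restrD (\<lambda>z. F z - ?S n z)) + (\<Sum>k. norm (a k) * znorm N k)" for n
  proof -
    have eq: "restrD F = (\<lambda>z. restrD (\<lambda>z. F z - ?S n z) z + restrD (?S n) z)"
      by (auto simp: restrD_def)
    have 1: "restrD (?S n) \<in> X"
      using restrD_poly_in[of "\<Sum>k<n. monom (a k) k"] by (simp add: poly_sum[abs_def] poly_monom)
    have "N (restrD F) \<le> N (restrD (\<lambda>z. F z - ?S n z)) + N (restrD (?S n))"
      by (subst eq) (rule N_add[OF restrD_in[OF entire_series_remainder[OF F]] 1])
    also have "N (restrD (?S n)) \<le> (\<Sum>k<n. norm (a k) * znorm N k)" by (rule N_partial_sum)
    also have "\<dots> \<le> (\<Sum>k. norm (a k) * znorm N k)"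
      by (intro sum_le_suminf[OF sm]) (auto intro: mult_nonneg_nonneg less_imp_le[OF znorm_pos])
    finally show ?thesis by simp
  qed
  moreover have "(\<lambda>n. N (restrD (\<lambda>z. F z - ?S n z)) + (\<Sum>k. norm (a k) * znorm N k)) \<longlonglongrightarrow> 0 + (\<Sum>k. norm (a k) * znorm N k)"
    by (intro tendsto_add remainder_tendsto_0[OF F] tendsto_const)
  ultimately show ?thesis by (intro LIMSEQ_le_const) auto
qed

section \<open>Best errors and Taylor coefficients\<close>

lemma best_err_le:
  assumes "f \<in> X" "degree p < n"
  shows "best_err N n f \<le> N (\<lambda>z. f z - restrD (poly p) z)"
  unfolding best_err_def
  by (rule cINF_lower) (use assms in \<open>auto intro!: bdd_belowI2[of _ 0] N_nonneg diff_in restrD_poly_in\<close>)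

lemma best_err_greatest:
  assumes "1 \<le> n" "\<And>p. degree p < n \<Longrightarrow> M \<le> N (\<lambda>z. f z - restrD (poly p) z)"
  shows "M \<le> best_err N n f"
  unfolding best_err_def
proof (rule cINF_greatest)
  \<comment> \<open>For n = 0 no polynomial qualifies; for n \<ge> 1 the zero polynomial
    does.\<close>
  show "{p :: complex poly. degree p < n} \<noteq> {}"
    using assms(1) by (auto intro!: exI[of _ 0])
qed (use assms in auto)

lemma best_err_nonneg: "f \<in> X \<Longrightarrow> 1 \<le> n \<Longrightarrow> 0 \<le> best_err N n f"
  by (intro best_err_greatest N_nonneg diff_in restrD_poly_in)

lemma best_err_antimono: "f \<in> X \<Longrightarrow> 1 \<le> m \<Longrightarrow> m \<le> n \<Longrightarrow> best_err N n f \<le> best_err N m f"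
  by (rule best_err_greatest) (auto intro: best_err_le)

text \<open>Subtracting a polynomial of degree below n leaves the n-th coefficient unchanged, so
  \<open>coeff_znorm_le\<close> bounds every competitor from below.\<close>

lemma coeff_le_best_err:
  assumes F: "entire_series a F" and "1 \<le> n"
  shows "norm (a n) * znorm N n \<le> best_err N n (restrD F)"
proof (rule best_err_greatest[OF \<open>1 \<le> n\<close>])
  fix p :: "complex poly" assume "degree p < n"
  then show "norm (a n) * znorm N n \<le> N (\<lambda>z. restrD F z - restrD (poly p) z)"
    using coeff_znorm_le[OF entire_series_diff[OF F entire_series_poly[of p]], of n]
    by (simp add: restrD_diff coeff_eq_0)
qed

text \<open>The Taylor section of degree below n is a competitor, and \<open>N_le_coeff_sum\<close>
  bounds its remainder.\<close>

lemma best_err_le_coeff_sum: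
  assumes F: "entire_series a F" and sm: "summable (\<lambda>k. norm (a k) * znorm N k)" and "1 \<le> n"
  shows "best_err N n (restrD F) \<le> (\<Sum>k. if k < n then 0 else norm (a k) * znorm N k)"
proof -
  let ?p = "\<Sum>k<n. monom (a k) k" and ?a = "\<lambda>k. if k < n then 0 else a k"
  have "degree ?p \<le> n - 1"
    by (intro degree_sum_le) (auto intro: order_trans[OF degree_monom_le])
  then have "best_err N n (restrD F) \<le> N (\<lambda>z. restrD F z - restrD (poly ?p) z)"
    using \<open>1 \<le> n\<close> by (intro best_err_le restrD_in[OF F]) auto
  also have "\<dots> = N (restrD (\<lambda>z. F z - (\<Sum>k<n. a k * z ^ k)))"
    by (simp add: restrD_diff poly_sum poly_monom)
  also have "\<dots> \<le> (\<Sum>k. norm (?a k) * znorm N k)"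
  proof (rule N_le_coeff_sum[OF entire_series_remainder[OF F]])
    show "summable (\<lambda>k. norm (?a k) * znorm N k)"
      using znorm_pos by (intro summable_comparison_test'[OF sm, of 0]) (auto simp: less_imp_le)
  qed
  also have "(\<lambda>k. norm (?a k) * znorm N k) = (\<lambda>k. if k < n then 0 else norm (a k) * znorm N k)"
    by auto
  finally show ?thesis .
qed

end

section \<open>Superexponential decay of the best errors\<close>

text \<open>One constant B encodes both geometric bounds on the norms of the powers. The exponent n
  + 1 leaves a spare factor B for the finitely many initial indices, including n = 0.\<close>

locale admissible_growth = admissible +
  fixes B :: real
  assumes B_ge_1: "1 \<le> B"
    and znorm_le: "znorm N n \<le> B ^ Suc n"
    and znorm_ge: "1 \<le> znorm N n * B ^ Suc n"
begin

lemma summable_coeff_znorm: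
  assumes "entire_series a F"
  shows "summable (\<lambda>k. norm (a k) * znorm N k)"
proof (rule summable_comparison_test')
  show "summable (\<lambda>k. B * (norm (a k) * B ^ k))"
    by (intro summable_mult entire_series_summable_norm[OF assms])
  show "norm (norm (a k) * znorm N k) \<le> B * (norm (a k) * B ^ k)" for k
    using mult_left_mono[OF znorm_le[of k], of "norm (a k)"] znorm_pos[of k] by (simp add: mult_ac)
qed

text \<open>For k \<ge> n the terms of the tail are at most B x^k with x = B n^(-1/\<sigma>) \<le>
  1/2, so the tail is at most 2 B (2x)^n. The lower bound on the norm of z^n then brings in that
  norm, and \<tau> absorbs the geometric factors.\<close>

lemma best_err_bound_of_coeff_bound:
  assumes F: "entire_series a F" and \<sigma>: "0 < \<sigma>" "\<sigma> < \<tau>"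
    and bd: "eventually (\<lambda>n. norm (a n) \<le> real n powr (- real n / \<sigma>)) sequentially"
  shows "eventually (\<lambda>n. best_err N n (restrD F) \<le> znorm N n * real n powr (- real n / \<tau>)) sequentially"
proof -
  have "0 < 2 * B * B" using B_ge_1 by simp
  \<comment> \<open>The constant collects 2 B (2 B)^n from the tail and B^(n+1) from
    \<open>znorm_ge\<close>.\<close>
  then have "eventually (\<lambda>n. 2 * B * B * (2 * B * B) ^ n * real n powr (- real n / \<sigma>) \<le> real n powr (- real n / \<tau>)) sequentially"
    using \<sigma> by (intro superexp_absorb)
  moreover have "eventually (\<lambda>n. B * real n powr (- 1 / \<sigma>) \<le> 1 / 2) sequentially"
    using \<sigma> B_ge_1 by real_asymp
  ultimately show ?thesis
    using eventually_all_ge_at_top[OF bd] eventually_ge_at_top[of 1]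
  proof eventually_elim
    case (elim n)
    define x where "x = B * real n powr (- 1 / \<sigma>)"
    have x: "0 \<le> x" "x \<le> 1 / 2" using elim B_ge_1 by (auto simp: x_def)
    have xn: "x ^ n = B ^ n * real n powr (- real n / \<sigma>)"
      using elim by (simp add: x_def power_mult_distrib powr_powr flip: powr_realpow)
    let ?u = "\<lambda>k. if k < n then 0 else norm (a k) * znorm N k"
    \<comment> \<open>Writing x^n (1/2)^(k-n) as (2x)^n (1/2)^k gives a geometric majorant indexed
      from k = 0.\<close>
    have bnd: "?u k \<le> B * (2 * x) ^ n * (1/2) ^ k" for k
    proof (cases "k < n")
      case False
      then have k: "n \<le> k" "0 < real k" "k = n + (k - n)" using elim by auto
      have "norm (a k) * znorm N k \<le> real k powr (- real k / \<sigma>) * B ^ Suc k"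
        using elim k znorm_le[of k] znorm_pos[of k] by (intro mult_mono) auto
      also have "\<dots> = B * (B * real k powr (- 1 / \<sigma>)) ^ k"
        using k by (simp add: power_mult_distrib powr_powr flip: powr_realpow)
      also have "\<dots> \<le> B * x ^ k"
        unfolding x_def using B_ge_1 k \<sigma> elim
        by (intro mult_left_mono power_mono powr_mono2') (auto simp: field_simps)
      also have "\<dots> = B * (x ^ n * x ^ (k - n))" using k by (metis power_add)
      also have "\<dots> \<le> B * (x ^ n * (1/2) ^ (k - n))"
        using x B_ge_1 by (intro mult_left_mono power_mono) auto
      also have "\<dots> = B * (2 * x) ^ n * (1/2) ^ k"
        by (subst (2) k(3)) (simp add: power_add power_mult_distrib power_divide)
      finally show ?thesis using False by simp
    qed (use x B_ge_1 in auto)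
    have s: "(\<lambda>k. B * (2 * x) ^ n * (1/2) ^ k) sums (B * (2 * x) ^ n * 2)"
      using geometric_sums[of "1/2::real"] by (intro sums_mult) simp
    have "best_err N n (restrD F) \<le> (\<Sum>k. ?u k)"
      using elim by (intro best_err_le_coeff_sum F summable_coeff_znorm[OF F]) auto
    also have "\<dots> \<le> B * (2 * x) ^ n * 2"
    proof -
      have "summable ?u"
        using znorm_pos by (intro summable_comparison_test'[OF summable_coeff_znorm[OF F], of 0]) (auto simp: less_imp_le)
      then show ?thesis using suminf_le[OF bnd _ sums_summable[OF s]] sums_unique[OF s] by simp
    qed
    also have "\<dots> = 2 * B * (2 * B) ^ n * real n powr (- real n / \<sigma>)"
      using xn by (simp add: power_mult_distrib)
    also have "\<dots> \<le> 2 * B * (2 * B) ^ n * real n powr (- real n / \<sigma>) * (znorm N n * B ^ Suc n)"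
      using mult_left_mono[OF znorm_ge[of n], of "2 * B * (2 * B) ^ n * real n powr (- real n / \<sigma>)"] B_ge_1 by simp
    also have "\<dots> = znorm N n * (2 * B * B * (2 * B * B) ^ n * real n powr (- real n / \<sigma>))"
      by (simp add: power_mult_distrib)
    also have "\<dots> \<le> znorm N n * real n powr (- real n / \<tau>)"
      using elim znorm_pos[of n] by (intro mult_left_mono) auto
    finally show ?case .
  qed
qed

section \<open>The error rate and its limsup\<close>

definition err_rate :: "(complex \<Rightarrow> complex) \<Rightarrow> nat \<Rightarrow> real" where
  "err_rate f n = real n * ln (real n) / ln (znorm N n / best_err N n f)"

lemma best_err_bound_of_entire_order:
  assumes "entire_series a F" "entire_order F < ereal \<tau>" "0 < \<tau>"
  shows "eventually (\<lambda>n. best_err N n (restrD F) \<le> znorm N n * real n powr (- real n / \<tau>)) sequentially"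
proof -
  have "max (entire_order F) 0 < ereal \<tau>" using assms by simp
  then obtain \<sigma> where "max (entire_order F) 0 < ereal \<sigma>" "ereal \<sigma> < ereal \<tau>"
    using ereal_dense2 by blast
  then have \<sigma>: "entire_order F < ereal \<sigma>" "0 < \<sigma>" "\<sigma> < \<tau>" by auto
  show ?thesis
    by (rule best_err_bound_of_coeff_bound[OF assms(1) \<sigma>(2,3) coeff_bound_of_entire_order[OF assms(1) \<sigma>(1,2)]])
qed

text \<open>Dividing \<open>coeff_le_best_err\<close> by the norm of z^n turns the error bound into
  the coefficient bound with the same \<sigma>.\<close>

lemma entire_order_le_of_best_err_bound:
  assumes F: "entire_series a F" and "0 < \<sigma>"
    and bd: "eventually (\<lambda>n. best_err N n (restrD F) \<le> znorm N n * real n powr (- real n / \<sigma>)) sequentially"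
  shows "entire_order F \<le> ereal \<sigma>"
proof (rule entire_order_le_of_coeff_bound[OF F \<open>0 < \<sigma>\<close>])
  show "eventually (\<lambda>n. norm (a n) \<le> real n powr (- real n / \<sigma>)) sequentially"
    using bd eventually_ge_at_top[of 1]
  proof eventually_elim
    case (elim n)
    then have "norm (a n) * znorm N n \<le> real n powr (- real n / \<sigma>) * znorm N n"
      using coeff_le_best_err[OF F, of n] by (simp add: mult.commute)
    then show ?case using znorm_pos[of n] by simp
  qed
qed

lemma err_rate_limsup_le:
  assumes f: "f \<in> X" and \<sigma>: "0 < \<sigma>"
    and bd: "eventually (\<lambda>n. best_err N n f \<le> znorm N n * real n powr (- real n / \<sigma>)) sequentially"
  shows "limsup (\<lambda>n. ereal (err_rate f n)) \<le> ereal \<sigma>"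
proof (rule Limsup_bounded)
  show "eventually (\<lambda>n. ereal (err_rate f n) \<le> ereal \<sigma>) sequentially"
    \<comment> \<open>From n = 2 on, n ln n is positive, so the logarithm in the denominator is
      positive and may be divided by.\<close>
    using bd eventually_ge_at_top[of 2]
  proof eventually_elim
    case (elim n)
    show ?case
    proof (cases "best_err N n f = 0")
      \<comment> \<open>A vanishing error gives the rate 0, by the conventions for division by 0 and
        for the logarithm of 0.\<close>
      case True
      then show ?thesis using \<sigma> by (simp add: err_rate_def)
    next
      case False
      then have E: "0 < best_err N n f" using best_err_nonneg[OF f, of n] elim by simp
      have "real n powr (real n / \<sigma>) \<le> znorm N n / best_err N n f"
        using elim E by (simp add: powr_minus field_simps)
      then have "ln (real n powr (real n / \<sigma>)) \<le> ln (znorm N n / best_err N n f)"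
        using elim by (intro ln_mono) auto
      then have le: "real n * ln (real n) / \<sigma> \<le> ln (znorm N n / best_err N n f)"
        using elim by (simp add: ln_powr)
      moreover have "0 < real n * ln (real n) / \<sigma>" using elim \<sigma> by simp
      ultimately have "0 < ln (znorm N n / best_err N n f)" by linarith
      with le \<sigma> show ?thesis by (simp add: err_rate_def field_simps)
    qed
  qed
qed

text \<open>Where \<^term>\<open>znorm N n < best_err N n f\<close> the rate is negative, so a bound on the limsup says nothing
  about \<^term>\<open>best_err N n f\<close> there.  Since the best errors decrease, a superexponentially
  small error at one index forces a positive rate at the next one.\<close>

lemma best_err_bound_of_err_rate:
  assumes f: "f \<in> X" and \<sigma>: "0 < \<sigma>"
    and ls: "limsup (\<lambda>n. ereal (err_rate f n)) < ereal \<sigma>"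
    and fr: "frequently (\<lambda>n. best_err N n f < znorm N n) sequentially"
  shows "eventually (\<lambda>n. best_err N n f \<le> znorm N n * real n powr (- real n / \<sigma>)) sequentially"
proof -
  let ?E = "\<lambda>n. best_err N n f"
  let ?good = "\<lambda>n. ?E n \<le> znorm N n * real n powr (- real n / \<sigma>)"
  have "(\<lambda>n. (B * B) ^ n * real n powr (- real n / \<sigma>)) \<longlonglongrightarrow> 0"
    using B_ge_1 \<sigma> by (intro superexp_tendsto_0) auto
  \<comment> \<open>The factor B^(n+1) from \<open>znorm_le\<close> at n and B^(n+2) from
    \<open>znorm_ge\<close> at n + 1 multiply to B^3 (B B)^n, whence the threshold.\<close>
  then have "eventually (\<lambda>n. (B * B) ^ n * real n powr (- real n / \<sigma>) < 1 / B ^ 3) sequentially"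
    by (rule order_tendstoD) (use B_ge_1 in auto)
  moreover have "eventually (\<lambda>n. err_rate f n < \<sigma>) sequentially"
    using Limsup_lessD[OF ls] by simp
  ultimately have "eventually (\<lambda>n. (B * B) ^ n * real n powr (- real n / \<sigma>) < 1 / B ^ 3 \<and> err_rate f n < \<sigma> \<and> 2 \<le> n) sequentially"
    using eventually_ge_at_top[of 2] by eventually_elim auto
  then obtain n1 where n1: "\<And>n. n1 \<le> n \<Longrightarrow> (B * B) ^ n * real n powr (- real n / \<sigma>) < 1 / B ^ 3"
      "\<And>n. n1 \<le> n \<Longrightarrow> err_rate f n < \<sigma>" "\<And>n. n1 \<le> n \<Longrightarrow> 2 \<le> n"
    unfolding eventually_sequentially by blast
  have good: "?good n" if "n1 \<le> n" "?E n < znorm N n" for n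
  proof (cases "?E n = 0")
    case True
    then show ?thesis using znorm_pos[of n] by simp
  next
    case False
    then have E: "0 < ?E n" using best_err_nonneg[OF f, of n] n1(3)[OF that(1)] by simp
    have "0 < ln (znorm N n / ?E n)" using E that by simp
    then have "real n / \<sigma> * ln (real n) \<le> ln (znorm N n / ?E n)"
      using n1(2)[OF that(1)] \<sigma> by (simp add: err_rate_def field_simps)
    then have "exp (real n / \<sigma> * ln (real n)) \<le> znorm N n / ?E n"
      using E znorm_pos[of n] by (simp add: ln_ge_iff)
    then have "real n powr (real n / \<sigma>) \<le> znorm N n / ?E n"
      using n1(3)[OF that(1)] by (simp add: powr_def)
    then show ?thesis using E n1(3)[OF that(1)] by (simp add: powr_minus field_simps)
  qed
  have step: "?E (Suc n) < znorm N (Suc n)" if "n1 \<le> n" "?good n" for n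
  proof -
    have B: "0 < B" using B_ge_1 by simp
    have "?E (Suc n) \<le> ?E n" using n1(3)[OF that(1)] by (intro best_err_antimono f) auto
    also have "\<dots> \<le> B ^ Suc n * real n powr (- real n / \<sigma>)"
      using that(2) mult_right_mono[OF znorm_le[of n], of "real n powr (- real n / \<sigma>)"] by simp
    finally have "?E (Suc n) * B ^ Suc (Suc n) \<le> B ^ Suc n * real n powr (- real n / \<sigma>) * B ^ Suc (Suc n)"
      using B by (intro mult_right_mono) auto
    also have "\<dots> = B ^ 3 * ((B * B) ^ n * real n powr (- real n / \<sigma>))"
      by (simp add: power_mult_distrib numeral_3_eq_3)
    also have "\<dots> < 1" using n1(1)[OF that(1)] B by (simp add: field_simps)
    also have "1 \<le> znorm N (Suc n) * B ^ Suc (Suc n)" by (rule znorm_ge)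
    finally show ?thesis using B by (simp del: power_Suc)
  qed
  obtain m where m: "n1 \<le> m" "?E m < znorm N m"
    using fr unfolding frequently_sequentially by blast
  have "?good n" if "m \<le> n" for n
    using that
  proof (induction n rule: dec_induct)
    case base
    show ?case using good m by simp
  next
    case (step n)
    then show ?case using good[of "Suc n"] \<open>n1 \<le> m\<close> by (simp add: \<open>\<And>n. n1 \<le> n \<Longrightarrow> ?good n \<Longrightarrow> ?E (Suc n) < znorm N (Suc n)\<close>)
  qed
  then show ?thesis unfolding eventually_sequentially by blast
qed

section \<open>Convergence of the best approximations\<close>

lemma N_le_sup:
  assumes F: "entire_series a F" and M: "\<And>z. norm z = 2 * B \<Longrightarrow> norm (F z) \<le> M"
  shows "N (restrD F) \<le> 2 * B * M"
proof -
  \<comment> \<open>Cauchy's estimate at radius 2B gains 2^(-k) against the growth B^(k+1) of the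
    norms of the powers.\<close>
  have bnd: "norm (a k) * znorm N k \<le> B * M * (1/2) ^ k" for k
  proof -
    have "norm (a k) * znorm N k \<le> norm (a k) * B ^ Suc k"
      using znorm_le[of k] by (intro mult_left_mono) auto
    also have "\<dots> = B * (norm (a k) * (2 * B) ^ k) * (1/2) ^ k"
      by (simp add: power_mult_distrib power_divide)
    also have "\<dots> \<le> B * M * (1/2) ^ k"
      using Cauchy_estimate[OF F M, of "2 * B" k] B_ge_1 by (intro mult_right_mono mult_left_mono) auto
    finally show ?thesis .
  qed
  have s: "(\<lambda>k. B * M * (1/2) ^ k) sums (B * M * 2)"
    using geometric_sums[of "1/2::real"] by (intro sums_mult) simp
  have "N (restrD F) \<le> (\<Sum>k. norm (a k) * znorm N k)"
    by (rule N_le_coeff_sum[OF F summable_coeff_znorm[OF F]])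
  also have "\<dots> \<le> B * M * 2"
    using suminf_le[OF bnd summable_coeff_znorm[OF F] sums_summable[OF s]] sums_unique[OF s] by simp
  finally show ?thesis by simp
qed

text \<open>Both p and q are within \<open>best_err N n f\<close> of f, so q - p has norm at most
  twice that. This controls each of its coefficients through \<open>znorm_ge\<close>, and there are
  at most n + 1 \<le> 2^n of them.\<close>

lemma best_approx_step_le:
  assumes f: "f \<in> X" and p: "is_best_approx N n f p" and q: "is_best_approx N (Suc n) f q"
    and n: "1 \<le> n" and z: "norm z \<le> R" "1 \<le> R"
  shows "norm (poly (q - p) z) \<le> 2 * B * (2 * B * R) ^ n * best_err N n f"
proof -
  let ?E = "best_err N n f"
  let ?g = "\<lambda>p z. f z - restrD (poly p) z"
  have g: "?g r \<in> X" for r by (intro diff_in f restrD_poly_in)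
  have E: "0 \<le> ?E" by (rule best_err_nonneg[OF f n])
  have "restrD (poly (q - p)) = (\<lambda>z. ?g p z - ?g q z)" by (auto simp: restrD_def)
  then have "N (restrD (poly (q - p))) \<le> N (?g p) + N (?g q)" by (simp only: N_diff[OF g g])
  also have "\<dots> = ?E + best_err N (Suc n) f" using p q by (simp add: is_best_approx_def)
  also have "\<dots> \<le> 2 * ?E" using best_err_antimono[OF f n, of "Suc n"] by simp
  finally have N: "N (restrD (poly (q - p))) \<le> 2 * ?E" .
  have deg: "degree (q - p) \<le> n"
    using p q by (intro degree_diff_le) (auto simp: is_best_approx_def)
  have c: "norm (coeff (q - p) j * z ^ j) \<le> 2 * ?E * B ^ Suc n * R ^ n" if "j \<le> n" for j
  proof -
    have "norm (coeff (q - p) j) \<le> norm (coeff (q - p) j) * (znorm N j * B ^ Suc j)"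
      using mult_left_mono[OF znorm_ge[of j], of "norm (coeff (q - p) j)"] by simp
    also have "\<dots> = (norm (coeff (q - p) j) * znorm N j) * B ^ Suc j" by simp
    also have "\<dots> \<le> (2 * ?E) * B ^ Suc n"
      using order_trans[OF coeff_znorm_le[OF entire_series_poly, of "q - p" j] N] that B_ge_1 E
      by (intro mult_mono[OF _ power_increasing]) auto
    finally have "norm (coeff (q - p) j) \<le> 2 * ?E * B ^ Suc n" .
    moreover have "norm z ^ j \<le> R ^ n"
      using power_mono[OF z(1), of j] power_increasing[OF that z(2)] by simp
    ultimately show ?thesis using E B_ge_1
      by (simp only: norm_mult norm_power) (intro mult_mono, auto)
  qed
  have "poly (q - p) z = (\<Sum>j\<le>n. coeff (q - p) j * z ^ j)"
    unfolding poly_altdef using deg by (intro sum.mono_neutral_left) (auto simp: coeff_eq_0 simp del: coeff_diff)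
  then have "norm (poly (q - p) z) \<le> (\<Sum>j\<le>n. 2 * ?E * B ^ Suc n * R ^ n)"
    by (simp only:) (intro sum_norm_le c, simp)
  also have "\<dots> = real (Suc n) * (2 * ?E * B ^ Suc n * R ^ n)" by simp
  also have "\<dots> \<le> 2 ^ n * (2 * ?E * B ^ Suc n * R ^ n)"
    using E B_ge_1 z by (intro mult_right_mono) (auto simp: Suc_le_eq simp flip: of_nat_Suc)
  also have "\<dots> = 2 * B * (2 * B * R) ^ n * ?E" by (simp add: power_mult_distrib)
  finally show ?thesis .
qed

lemma best_err_geometric:
  assumes \<sigma>: "0 < \<sigma>" "0 < K"
    and bd: "eventually (\<lambda>n. best_err N n f \<le> znorm N n * real n powr (- real n / \<sigma>)) sequentially"
  shows "eventually (\<lambda>n. K ^ n * best_err N n f \<le> 1) sequentially"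
proof -
  have "(\<lambda>n. (K * B) ^ n * real n powr (- real n / \<sigma>)) \<longlonglongrightarrow> 0"
    using B_ge_1 \<sigma> by (intro superexp_tendsto_0) auto
  then have "eventually (\<lambda>n. (K * B) ^ n * real n powr (- real n / \<sigma>) < 1 / B) sequentially"
    by (rule order_tendstoD) (use B_ge_1 in auto)
  with bd show ?thesis
  proof eventually_elim
    case (elim n)
    have "K ^ n * best_err N n f \<le> K ^ n * (B ^ Suc n * real n powr (- real n / \<sigma>))"
      using elim \<sigma> mult_right_mono[OF znorm_le[of n], of "real n powr (- real n / \<sigma>)"]
      by (intro mult_left_mono) auto
    also have "\<dots> = B * ((K * B) ^ n * real n powr (- real n / \<sigma>))"
      by (simp add: power_mult_distrib)
    also have "\<dots> \<le> 1" using elim B_ge_1 by (simp add: field_simps)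
    finally show ?case .
  qed
qed

text \<open>The telescoping series of the differences has a geometric majorant on every disc, so its
  limit F is entire. In norm, p n approaches f by the decay of the errors and F by
  \<open>N_le_sup\<close>; hence f - F has norm 0.\<close>

lemma best_approx_converges:
  assumes f: "f \<in> X" and p: "\<And>n. 1 \<le> n \<Longrightarrow> is_best_approx N n f (p n)" and \<sigma>: "0 < \<sigma>"
    and bd: "eventually (\<lambda>n. best_err N n f \<le> znorm N n * real n powr (- real n / \<sigma>)) sequentially"
  obtains a F where "entire_series a F" "f = restrD F"
    "\<And>r. uniform_limit (ball 0 r) (\<lambda>n. poly (p n)) F sequentially"
proof -
  \<comment> \<open>The polynomial \<open>p 0\<close> is unconstrained, but it cancels in the
    telescoped partial sums.\<close>
  define F where "F = (\<lambda>z. poly (p 0) z + (\<Sum>k. poly (p (Suc k) - p k) z))"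
  have unif: "uniform_limit (ball 0 r) (\<lambda>n. poly (p n)) F sequentially" for r
  proof -
    define R where "R = max r 1"
    have R: "r \<le> R" "1 \<le> R" by (auto simp: R_def)
    \<comment> \<open>Twice the ratio 2BR of \<open>best_approx_step_le\<close>, so that a factor
      (1/2)^n remains.\<close>
    have "0 < 4 * B * R" using B_ge_1 R by simp
    from best_err_geometric[OF \<sigma> this bd] eventually_ge_at_top[of 1]
    have "eventually (\<lambda>n. \<forall>z\<in>ball 0 r. norm (poly (p (Suc n) - p n) z) \<le> 2 * B * (1/2) ^ n) sequentially"
    proof eventually_elim
      case (elim n)
      show ?case
      proof
        fix z :: complex assume "z \<in> ball 0 r"
        then have "norm (poly (p (Suc n) - p n) z) \<le> 2 * B * (2 * B * R) ^ n * best_err N n f"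
          using elim R by (intro best_approx_step_le f p) auto
        also have "\<dots> = 2 * B * (1/2) ^ n * ((4 * B * R) ^ n * best_err N n f)"
        proof -
          have "(4 * B * R) ^ n = 2 ^ n * (2 * B * R) ^ n"
            unfolding power_mult_distrib[symmetric] by (rule arg_cong) simp
          then show ?thesis by (simp add: power_one_over)
        qed
        also have "\<dots> \<le> 2 * B * (1/2) ^ n * 1"
          using elim B_ge_1 by (intro mult_left_mono) auto
        finally show "norm (poly (p (Suc n) - p n) z) \<le> 2 * B * (1/2) ^ n" by simp
      qed
    qed
    then have "uniform_limit (ball 0 r) (\<lambda>n z. \<Sum>k<n. poly (p (Suc k) - p k) z)
        (\<lambda>z. \<Sum>k. poly (p (Suc k) - p k) z) sequentially"
      by (rule Weierstrass_m_test_ev) (intro summable_mult, simp)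
    then have "uniform_limit (ball 0 r) (\<lambda>n z. poly (p 0) z + (\<Sum>k<n. poly (p (Suc k) - p k) z)) F sequentially"
      unfolding F_def by (intro uniform_limit_intros)
    moreover have "poly (p 0) z + (\<Sum>k<n. poly (p (Suc k) - p k) z) = poly (p n) z" for n z
      by (simp add: sum_lessThan_telescope[of "\<lambda>k. poly (p k) z"])
    ultimately show ?thesis by simp
  qed
  have "F holomorphic_on UNIV"
  proof (rule holomorphic_uniform_sequence)
    fix x :: complex
    have "cball x 1 \<subseteq> ball 0 (norm x + 2)"
      by (simp add: cball_subset_ball_iff)
    then have "uniform_limit (cball x 1) (\<lambda>n. poly (p n)) F sequentially"
      using unif uniform_limit_on_subset by blast
    then show "\<exists>d>0. cball x d \<subseteq> UNIV \<and> uniform_limit (cball x d) (\<lambda>n. poly (p n)) F sequentially"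
      by (intro exI[of _ 1]) simp
  qed (auto intro!: holomorphic_intros)
  then obtain a where F: "entire_series a F" by (rule holomorphic_imp_entire_series)
  have d: "(\<lambda>z. f z - restrD F z) \<in> X" by (intro diff_in f restrD_in[OF F])
  have "N (\<lambda>z. f z - restrD F z) \<le> e" if "0 < e" for e
  proof -
    \<comment> \<open>The factor 2B of \<open>N_le_sup\<close> turns e' into e/2. The circle of
      radius 2B in that lemma lies inside the open ball of radius 2B + 1 used next.\<close>
    define e' where "e' = e / (4 * B)"
    have "0 < e'" using that B_ge_1 by (simp add: e'_def)
    with unif[of "2 * B + 1"]
    have "eventually (\<lambda>n. \<forall>z\<in>ball 0 (2 * B + 1). dist (poly (p n) z) (F z) < e') sequentially"
      by (rule uniform_limitD)
    moreover have "eventually (\<lambda>n. 2 ^ n * best_err N n f \<le> 1) sequentially"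
      by (rule best_err_geometric[OF \<sigma> _ bd]) simp
    moreover have "eventually (\<lambda>n. (1/2) ^ n \<le> e / 2) sequentially"
      using that by real_asymp
    ultimately have "eventually (\<lambda>n. N (\<lambda>z. f z - restrD F z) \<le> e) sequentially"
      using eventually_ge_at_top[of 1]
    proof eventually_elim
      case (elim n)
      have 1: "N (restrD (\<lambda>z. poly (p n) z - F z)) \<le> 2 * B * e'"
        by (rule N_le_sup[OF entire_series_diff[OF entire_series_poly F]])
          (use elim in \<open>auto simp: dist_norm less_imp_le\<close>)
      have "(\<lambda>z. f z - restrD F z) = (\<lambda>z. (f z - restrD (poly (p n)) z) + restrD (\<lambda>z. poly (p n) z - F z) z)"
        by (auto simp: restrD_def)
      then have "N (\<lambda>z. f z - restrD F z) \<le> N (\<lambda>z. f z - restrD (poly (p n)) z) + N (restrD (\<lambda>z. poly (p n) z - F z))"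
        using N_add[OF diff_in[OF f restrD_poly_in] restrD_in[OF entire_series_diff[OF entire_series_poly F]]] by simp
      also have "N (\<lambda>z. f z - restrD (poly (p n)) z) = best_err N n f"
        using p elim by (simp add: is_best_approx_def)
      also have "best_err N n f \<le> (1/2) ^ n" using elim by (simp add: power_divide field_simps)
      also have "(1/2) ^ n + N (restrD (\<lambda>z. poly (p n) z - F z)) \<le> e / 2 + 2 * B * e'"
        using 1 elim by (intro add_mono) auto
      also have "\<dots> = e" using B_ge_1 by (simp add: e'_def)
      finally show ?case by simp
    qed
    then show ?thesis by simp
  qed
  then have "N (\<lambda>z. f z - restrD F z) \<le> 0" by (meson dense_ge)
  with N_nonneg[OF d] N_eq_0[OF d] have "(\<lambda>z. f z - restrD F z) = (\<lambda>z. 0)" by linarith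
  then have "f = restrD F" by (auto simp: fun_eq_iff)
  with that F unif show thesis by blast
qed

section \<open>The two directions of the equivalence\<close>

lemma err_rate_limsup_eq:
  assumes F: "entire_series a F" and ord: "entire_order F = ereal \<rho>" and \<rho>: "0 < \<rho>"
  shows "limsup (\<lambda>n. ereal (err_rate (restrD F) n)) = ereal \<rho>"
proof (rule antisym)
  let ?f = "restrD F"
  show "limsup (\<lambda>n. ereal (err_rate ?f n)) \<le> ereal \<rho>"
  \<comment> \<open>The error bound holds for each \<tau> strictly above \<rho>, so a limsup above
    \<rho> is refuted by a \<tau> in between.\<close>
  proof (rule ccontr)
    assume "\<not> ?thesis"
    then obtain \<tau> where \<tau>: "ereal \<rho> < ereal \<tau>" "ereal \<tau> < limsup (\<lambda>n. ereal (err_rate ?f n))"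
      using ereal_dense2[of "ereal \<rho>"] by (auto simp: not_le)
    have "limsup (\<lambda>n. ereal (err_rate ?f n)) \<le> ereal \<tau>"
      using \<tau> \<rho> ord by (intro err_rate_limsup_le restrD_in[OF F] best_err_bound_of_entire_order[OF F]) auto
    with \<tau> show False by simp
  qed
  show "ereal \<rho> \<le> limsup (\<lambda>n. ereal (err_rate ?f n))"
  proof (rule ccontr)
    assume "\<not> ?thesis"
    then have "max (limsup (\<lambda>n. ereal (err_rate ?f n))) 0 < ereal \<rho>" using \<rho> by simp
    then obtain \<sigma> where "max (limsup (\<lambda>n. ereal (err_rate ?f n))) 0 < ereal \<sigma>" "ereal \<sigma> < ereal \<rho>"
      using ereal_dense2 by blast
    then have \<sigma>: "limsup (\<lambda>n. ereal (err_rate ?f n)) < ereal \<sigma>" "0 < \<sigma>" "\<sigma> < \<rho>" by auto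
    \<comment> \<open>Any exponent above \<rho> would do: the aim is that the error eventually falls
      below the norm of z^n, the starting condition of
      \<open>best_err_bound_of_err_rate\<close>.\<close>
    have "eventually (\<lambda>n. best_err N n ?f \<le> znorm N n * real n powr (- real n / (\<rho> + 1))) sequentially"
      using ord \<rho> by (intro best_err_bound_of_entire_order[OF F]) auto
    moreover have "eventually (\<lambda>n. real n powr (- real n / (\<rho> + 1)) < 1) sequentially"
      using \<rho> by real_asymp
    ultimately have "eventually (\<lambda>n. best_err N n ?f < znorm N n) sequentially"
    proof eventually_elim
      case (elim n)
      then show ?case using znorm_pos[of n]
        by (smt (verit) mult_less_cancel_left2)
    qed
    then have "entire_order F \<le> ereal \<sigma>"
      using \<sigma> by (intro entire_order_le_of_best_err_bound[OF F] best_err_bound_of_err_rate restrD_in[OF F])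
        (auto intro: eventually_frequently)
    with ord \<sigma> show False by simp
  qed
qed

text \<open>A positive limsup yields error bounds for all \<tau> > \<rho>. One of them constructs F,
  all of them together bound its order by \<rho>, and a smaller order would make the limsup smaller
  than \<rho>.\<close>

lemma err_rate_limsup_eq_converse:
  assumes f: "f \<in> X" and ls: "limsup (\<lambda>n. ereal (err_rate f n)) = ereal \<rho>" and \<rho>: "0 < \<rho>"
    and p: "\<And>n. 1 \<le> n \<Longrightarrow> is_best_approx N n f (p n)"
  obtains F where "F holomorphic_on UNIV" "entire_order F = ereal \<rho>"
    "\<And>r. uniform_limit (ball 0 r) (\<lambda>n. poly (p n)) F sequentially"
proof -
  \<comment> \<open>If the error were eventually at least the norm of z^n, the logarithm and hence
    the rate would be nonpositive, against \<rho> > 0.\<close>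
  have "frequently (\<lambda>n. best_err N n f < znorm N n) sequentially"
  proof (rule ccontr)
    assume "\<not> ?thesis"
    then have "eventually (\<lambda>n. znorm N n \<le> best_err N n f) sequentially"
      by (simp add: not_frequently not_less)
    then have "eventually (\<lambda>n. ereal (err_rate f n) \<le> 0) sequentially"
      using eventually_ge_at_top[of 1]
    proof eventually_elim
      case (elim n)
      then have "ln (znorm N n / best_err N n f) \<le> 0" using znorm_pos[of n] by simp
      then show ?case using elim by (auto simp: err_rate_def intro!: divide_nonneg_nonpos)
    qed
    then have "limsup (\<lambda>n. ereal (err_rate f n)) \<le> 0" by (rule Limsup_bounded)
    with ls \<rho> show False by simp
  qed
  then have bd: "eventually (\<lambda>n. best_err N n f \<le> znorm N n * real n powr (- real n / \<tau>)) sequentially"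
    if "\<rho> < \<tau>" for \<tau>
    using that ls \<rho> by (intro best_err_bound_of_err_rate f) auto
  have \<rho>1: "0 < \<rho> + 1" "\<rho> < \<rho> + 1" using \<rho> by auto
  obtain a F where F: "entire_series a F" "f = restrD F"
    and unif: "\<And>r. uniform_limit (ball 0 r) (\<lambda>n. poly (p n)) F sequentially"
    using best_approx_converges[OF f p \<rho>1(1) bd[OF \<rho>1(2)]] by blast
  have le: "entire_order F \<le> ereal \<rho>"
  proof (rule ccontr)
    assume "\<not> ?thesis"
    then obtain \<tau> where \<tau>: "ereal \<rho> < ereal \<tau>" "ereal \<tau> < entire_order F"
      using ereal_dense2[of "ereal \<rho>"] by (auto simp: not_le)
    have "entire_order F \<le> ereal \<tau>"
      using \<tau> \<rho> bd[of \<tau>] F by (intro entire_order_le_of_best_err_bound[OF F(1)]) auto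
    with \<tau> show False by simp
  qed
  have "entire_order F = ereal \<rho>"
  proof (rule ccontr)
    assume "\<not> ?thesis"
    with le have "max (entire_order F) 0 < ereal \<rho>" using \<rho> by simp
    then obtain \<sigma> where "max (entire_order F) 0 < ereal \<sigma>" "ereal \<sigma> < ereal \<rho>"
      using ereal_dense2 by blast
    then have \<sigma>: "entire_order F < ereal \<sigma>" "0 < \<sigma>" "\<sigma> < \<rho>" by auto
    then have "limsup (\<lambda>n. ereal (err_rate f n)) \<le> ereal \<sigma>"
      using best_err_bound_of_entire_order[OF F(1)] F by (intro err_rate_limsup_le f) auto
    with ls \<sigma> show False by simp
  qed
  then show thesis by (rule that[OF entire_series_holomorphic[OF F(1)] _ unif])
qed

end

text \<open>The root conditions give geometric bounds from some index m on; the finitely many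
  earlier indices are absorbed by enlarging B.\<close>

lemma admissible_growthI:
  assumes adm: "admissible_space X N"
    and lo: "0 < liminf (\<lambda>n. ereal (znorm N n powr (1 / real n)))"
    and hi: "limsup (\<lambda>n. ereal (znorm N n powr (1 / real n))) < \<infinity>"
  obtains B where "admissible_growth X N B"
proof -
  interpret admissible X N by unfold_locales (rule adm)
  let ?w = "znorm N"
  obtain c where c: "0 < c" "ereal c < liminf (\<lambda>n. ereal (?w n powr (1 / real n)))"
    using ereal_dense2[OF lo] by auto
  obtain C where C: "limsup (\<lambda>n. ereal (?w n powr (1 / real n))) < ereal C"
    using ereal_dense2[OF hi] by auto
  \<comment> \<open>The absolute value supplies a nonnegative base without a separate sign argument
    for C.\<close>
  have "eventually (\<lambda>n. c ^ n \<le> ?w n \<and> ?w n \<le> \<bar>C\<bar> ^ n) sequentially"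
    using less_LiminfD[OF c(2)] Limsup_lessD[OF C] eventually_ge_at_top[of 1]
  proof eventually_elim
    case (elim n)
    have "(?w n powr (1 / real n)) ^ n = ?w n"
      using elim znorm_pos[of n] by (simp add: powr_powr flip: powr_realpow)
    moreover have "c ^ n \<le> (?w n powr (1 / real n)) ^ n" using elim c by (intro power_mono) auto
    moreover have "(?w n powr (1 / real n)) ^ n \<le> \<bar>C\<bar> ^ n" using elim by (intro power_mono) auto
    ultimately show ?case by simp
  qed
  then obtain m where m: "\<And>n. m \<le> n \<Longrightarrow> c ^ n \<le> ?w n" "\<And>n. m \<le> n \<Longrightarrow> ?w n \<le> \<bar>C\<bar> ^ n"
    unfolding eventually_sequentially by blast
  \<comment> \<open>S dominates both the norm of z^n and its reciprocal for every n < m.\<close>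
  define S where "S = (\<Sum>n<m. ?w n + 1 / ?w n)"
  define B where "B = 1 + \<bar>C\<bar> + 1 / c + S"
  have S: "?w n + 1 / ?w n \<le> S" if "n < m" for n
    unfolding S_def using that znorm_pos by (intro member_le_sum) (auto intro!: add_nonneg_nonneg simp: less_imp_le)
  have S0: "0 \<le> S" unfolding S_def using znorm_pos by (intro sum_nonneg add_nonneg_nonneg) (auto simp: less_imp_le)
  have B: "1 \<le> B" "\<bar>C\<bar> \<le> B" "1 / c \<le> B" "S \<le> B" using S0 c by (auto simp: B_def)
  have pw: "x \<le> B \<Longrightarrow> 0 \<le> x \<Longrightarrow> x ^ n \<le> B ^ Suc n" for x n
    using power_mono[of x B n] power_increasing[of n "Suc n" B] B by linarith
  have B1: "B \<le> B ^ Suc n" for n using power_increasing[of 1 "Suc n" B] B by simp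
  have "?w n \<le> B ^ Suc n \<and> 1 / ?w n \<le> B ^ Suc n" for n
  proof (cases "n < m")
    case True
    have "0 < 1 / ?w n" using znorm_pos[of n] by simp
    then show ?thesis using S[OF True] znorm_pos[of n] B B1[of n] by linarith
  next
    case False
    then have "1 / ?w n \<le> (1 / c) ^ n" using m(1)[of n] znorm_pos[of n] c
      by (simp add: power_divide frac_le)
    then show ?thesis using False m(2)[of n] pw[of "\<bar>C\<bar>" n] pw[of "1 / c" n] B c by force
  qed
  then have "admissible_growth X N B"
    using B znorm_pos by unfold_locales (auto simp: field_simps)
  then show thesis by (rule that)
qed

theorem theorem4p2:
  fixes X :: "(complex \<Rightarrow> complex) set" and N :: "(complex \<Rightarrow> complex) \<Rightarrow> real"
    and f :: "complex \<Rightarrow> complex"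
  assumes "admissible_space X N"
    and "0 < liminf (\<lambda>n. ereal (znorm N n powr (1 / real n)))"
    and "limsup (\<lambda>n. ereal (znorm N n powr (1 / real n))) < \<infinity>"
    and "f \<in> X"
  shows "(\<forall>\<rho>::real. 0 < \<rho> \<longrightarrow>
            (\<exists>F. F holomorphic_on UNIV \<and> f = restrD F \<and> entire_order F = ereal \<rho>) \<longrightarrow>
            limsup (\<lambda>n. ereal (real n * ln (real n) / ln (znorm N n / best_err N n f))) = ereal \<rho>)
       \<and> (\<forall>\<rho>::real. 0 < \<rho> \<longrightarrow>
            limsup (\<lambda>n. ereal (real n * ln (real n) / ln (znorm N n / best_err N n f))) = ereal \<rho> \<longrightarrow>
            (\<forall>p :: nat \<Rightarrow> complex poly. (\<forall>n\<ge>1. is_best_approx N n f (p n)) \<longrightarrow>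
              (\<exists>F. F holomorphic_on UNIV \<and> entire_order F = ereal \<rho> \<and>
                 (\<forall>r. 0 < r \<and> ereal r < liminf (\<lambda>n. ereal (znorm N n powr (1 / real n))) \<longrightarrow>
                    uniform_limit (ball 0 r) (\<lambda>n. poly (p n)) F sequentially))))"
proof -
  obtain B where "admissible_growth X N B" by (rule admissible_growthI[OF assms(1-3)])
  then interpret admissible_growth X N B .
  show ?thesis
    unfolding err_rate_def[symmetric]
  proof (intro conjI allI impI)
    fix \<rho> :: real
    assume \<rho>: "0 < \<rho>" and "\<exists>F. F holomorphic_on UNIV \<and> f = restrD F \<and> entire_order F = ereal \<rho>"
    then obtain F where F: "F holomorphic_on UNIV" "f = restrD F" "entire_order F = ereal \<rho>"
      by blast
    obtain a where "entire_series a F" using F(1) by (rule holomorphic_imp_entire_series)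
    from err_rate_limsup_eq[OF this F(3) \<rho>] show "limsup (\<lambda>n. ereal (err_rate f n)) = ereal \<rho>"
      by (simp add: F(2))
  next
    fix \<rho> :: real and p :: "nat \<Rightarrow> complex poly"
    assume \<rho>: "0 < \<rho>" "limsup (\<lambda>n. ereal (err_rate f n)) = ereal \<rho>"
      and "\<forall>n\<ge>1. is_best_approx N n f (p n)"
    then have "\<And>n. 1 \<le> n \<Longrightarrow> is_best_approx N n f (p n)" by blast
    from err_rate_limsup_eq_converse[OF \<open>f \<in> X\<close> \<rho>(2,1) this]
    obtain F where "F holomorphic_on UNIV" "entire_order F = ereal \<rho>"
      "\<And>r. uniform_limit (ball 0 r) (\<lambda>n. poly (p n)) F sequentially"
      by blast
    then show "\<exists>F. F holomorphic_on UNIV \<and> entire_order F = ereal \<rho> \<and>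
        (\<forall>r. 0 < r \<and> ereal r < liminf (\<lambda>n. ereal (znorm N n powr (1 / real n))) \<longrightarrow>
          uniform_limit (ball 0 r) (\<lambda>n. poly (p n)) F sequentially)"
      by blast
  qed
qed

end
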